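(* Let an isometry $T=\begin{bmatrix} BU & CV\\ C^*U & EV\end{bmatrix}\in\mathcal G$ (with $K=\mathbb C^n$) be such that $\dim(\operatorname{ran} C)=k$. Then $T$ is non-unitary normal (that is, normal and not unitary as an operator on the Hilbert space $H\oplus\mathbb C^n$) if and only if it possesses exactly $2^k$ fixed points of the generic type. The generic fixed points lie on the boundary of the unit ball $\mathcal B$ of $B(\mathbb C^n,H)$.
   Context: $H$ is a complex Hilbert space and $K=\mathbb C^n$; $H$ and $K$ have different (Hilbert) dimensions. $B(K,H)$ is the Banach space of bounded linear operators $K\to H$ with the operator norm, $\mathcal B$ is its open unit ball, and $U(H)$, $U(K)$ are the unitary groups. $\mathcal G$ is the group of all bijective linear operators on $H\oplus K$ that leave invariant the Hermitian form $\mathcal S((h_1,k_1),(h_2,k_2))=\langle h_1,h_2\rangle-\langle k_1,k_2\rangle$; its elements are called isometries. Every $T\in\mathcal G$ is written as $T=\begin{bmatrix} BU & CV\\ C^*U & EV\end{bmatrix}$ with $U\in U(H)$, $V\in U(K)$, $B=(I-AA^* )^{-1/2}$, $C=(I-AA^* )^{-1/2}A$, $E=(I-A^*A)^{-1/2}$ for some $A\in\mathcal B$; $\operatorname{ran}C$ is the range of $C$. Fixed point: $F\in B(\mathbb C^n,H)$ is called a fixed point of $T\in\mathcal G$ if there is a basis $\{z_r\}_{r=1}^n$ of $\mathbb C^n$ such that the vectors $\begin{bmatrix}F(z_r)\\ z_r\end{bmatrix}\in H\oplus\mathbb C^n$, $r=1,\dots,n$, are eigenvectors of $T$. Generic type: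 let $S=\{(\epsilon_m)_{m=1}^q:\epsilon_m\in\{1,-1\}\}$ be the collection of such $q$-tuples, where $q\le n$; let $\{z_r\}_{r=1}^n$ be an orthonormal basis of $\mathbb C^n$ and $y_1,\dots,y_q$ non-zero vectors in $H$. For $\theta=(\epsilon_m)_{m=1}^q\in S$ define $F_\theta\in B(\mathbb C^n,H)$ by $F_\theta(z_m)=\epsilon_m y_m$ for $m=1,\dots,q$ and $F_\theta(z_s)=0$ for $s=q+1,\dots,n$. The functions $F_\theta$ are said to be of generic type; there are $|S|=2^q$ of them. If the vectors $\begin{bmatrix}F_\theta(z_r)\\ z_r\end{bmatrix}$, $r=1,\dots,n$, $\theta\in S$, are eigenvectors of $T$, then the $F_\theta$ are called fixed points of generic type (generic fixed points) of $T$.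
   Formalization: Generic type is taken with q ≥ 1 (for q = 0 the zero map would refute the claim for unitary T); "exactly 2^k" means one system {F_θ} with 2^k members exists, as the total over all bases can be infinite; the boundary claim is for such 2^k-member systems, as it fails when q > k. *)

theory Defs
  imports "HOL-Analysis.Analysis" "HOL-Library.Equipollence" "HOL-Library.FuncSet"
begin

class complex_inner = real_normed_vector +
  fixes scaleC :: "complex \<Rightarrow> 'a \<Rightarrow> 'a"  (infixr \<open>*\<^sub>C\<close> 75)
    and cinner :: "'a \<Rightarrow> 'a \<Rightarrow> complex"
  assumes scaleC_add_right: "a *\<^sub>C (x + y) = a *\<^sub>C x + a *\<^sub>C y"
    and scaleC_add_left: "(a + b) *\<^sub>C x = a *\<^sub>C x + b *\<^sub>C x"
    and scaleC_scaleC: "a *\<^sub>C (b *\<^sub>C x) = (a * b) *\<^sub>C x"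
    and scaleC_one: "1 *\<^sub>C x = x"
    and scaleR_scaleC: "r *\<^sub>R x = complex_of_real r *\<^sub>C x"
    and cinner_commute: "cinner x y = cnj (cinner y x)"
    and cinner_add_left: "cinner (x + y) z = cinner x z + cinner y z"
    and cinner_scaleC_left: "cinner (a *\<^sub>C x) y = a * cinner x y"
    and cinner_self: "cinner x x = complex_of_real ((norm x)\<^sup>2)"

class chilbert_space = complex_inner + complete_space

instantiation complex :: chilbert_space
begin
definition scaleC_complex :: "complex \<Rightarrow> complex \<Rightarrow> complex" where "scaleC_complex a x = a * x"
definition cinner_complex :: "complex \<Rightarrow> complex \<Rightarrow> complex" where "cinner_complex x y = x * cnj y"
instance
proof
  fix x :: complex
  show "cinner x x = complex_of_real ((norm x)\<^sup>2)"
    unfolding cinner_complex_def by (rule complex_norm_square [symmetric])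
qed (auto simp: scaleC_complex_def cinner_complex_def algebra_simps scaleR_conv_of_real)
end

text \<open>The norm that the library puts on products and on \<open>'a ^ 'n\<close> is the Euclidean one, so these
  are the Hilbert sum and the Hilbert space of finite sequences.\<close>

instantiation prod :: (complex_inner, complex_inner) complex_inner
begin
definition scaleC_prod :: "complex \<Rightarrow> 'a \<times> 'b \<Rightarrow> 'a \<times> 'b"
  where "scaleC_prod a x = (a *\<^sub>C fst x, a *\<^sub>C snd x)"
definition cinner_prod :: "'a \<times> 'b \<Rightarrow> 'a \<times> 'b \<Rightarrow> complex"
  where "cinner_prod x y = cinner (fst x) (fst y) + cinner (snd x) (snd y)"
instance
proof
  fix x y :: "'a \<times> 'b"
  show "cinner x y = cnj (cinner y x)"
    unfolding cinner_prod_def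
    by (metis cinner_commute complex_cnj_add)
  show "cinner x x = complex_of_real ((norm x)\<^sup>2)"
    by (simp add: cinner_prod_def cinner_self norm_prod_def)
qed (auto simp: scaleC_prod_def cinner_prod_def scaleC_add_right scaleC_add_left scaleC_scaleC
      scaleC_one scaleR_scaleC cinner_add_left cinner_scaleC_left algebra_simps prod_eq_iff)
end

instance prod :: (chilbert_space, chilbert_space) chilbert_space ..

instantiation vec :: (complex_inner, finite) complex_inner
begin
definition scaleC_vec :: "complex \<Rightarrow> 'a ^ 'b \<Rightarrow> 'a ^ 'b"
  where "scaleC_vec a x = (\<chi> i. a *\<^sub>C (x $ i))"
definition cinner_vec :: "'a ^ 'b \<Rightarrow> 'a ^ 'b \<Rightarrow> complex"
  where "cinner_vec x y = (\<Sum>i\<in>UNIV. cinner (x $ i) (y $ i))"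
instance
proof
  fix x y :: "'a ^ 'b"
  show "cinner x y = cnj (cinner y x)"
    unfolding cinner_vec_def cnj_sum
    by (intro sum.cong refl cinner_commute)
  show "cinner x x = complex_of_real ((norm x)\<^sup>2)"
    by (simp add: cinner_vec_def cinner_self norm_vec_def L2_set_def sum_nonneg)
qed (auto simp: scaleC_vec_def cinner_vec_def scaleC_add_right scaleC_add_left scaleC_scaleC
      scaleC_one scaleR_scaleC cinner_add_left cinner_scaleC_left sum.distrib sum_distrib_left
      vec_eq_iff)
end

instance vec :: (chilbert_space, finite) chilbert_space ..

global_interpretation complex_vector:
  vector_space "scaleC :: complex \<Rightarrow> 'a \<Rightarrow> 'a::complex_inner"
  by standard (simp_all add: scaleC_add_right scaleC_add_left scaleC_scaleC scaleC_one)

definition is_onb :: "'a::complex_inner set \<Rightarrow> bool" where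
  "is_onb S \<longleftrightarrow> (\<forall>x\<in>S. norm x = 1) \<and> (\<forall>x\<in>S. \<forall>y\<in>S. x \<noteq> y \<longrightarrow> cinner x y = 0)
     \<and> closure (complex_vector.span S) = UNIV"

definition same_hilbert_dim :: "'a::chilbert_space itself \<Rightarrow> 'b::chilbert_space itself \<Rightarrow> bool" where
  "same_hilbert_dim _ _ \<longleftrightarrow>
     (\<exists>(S :: 'a set) (S' :: 'b set). is_onb S \<and> is_onb S' \<and> S \<approx> S')"

abbreviation clinear :: "('a::complex_inner \<Rightarrow> 'b::complex_inner) \<Rightarrow> bool" where
  "clinear \<equiv> Vector_Spaces.linear scaleC scaleC"

definition bounded_clinear :: "('a::complex_inner \<Rightarrow> 'b::complex_inner) \<Rightarrow> bool" where
  "bounded_clinear f \<longleftrightarrow> clinear f \<and> (\<exists>M. \<forall>x. norm (f x) \<le> norm x * M)"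

lemma clinear_iff:
  "clinear f \<longleftrightarrow> (\<forall>x y. f (x + y) = f x + f y) \<and> (\<forall>c x. f (c *\<^sub>C x) = c *\<^sub>C f x)"
  unfolding Vector_Spaces.linear_def module_hom_def module_hom_axioms_def
  by (simp add: complex_vector.vector_space_axioms complex_vector.module_axioms)

lemma bounded_clinear_iff:
  "bounded_clinear f \<longleftrightarrow> bounded_linear f \<and> (\<forall>c x. f (c *\<^sub>C x) = c *\<^sub>C f x)"
  unfolding bounded_clinear_def clinear_iff bounded_linear_def bounded_linear_axioms_def
    linear_iff
  by (auto simp: scaleR_scaleC)

typedef (overloaded) ('a, 'b) cblinfun  (\<open>(\<open>notation=\<open>infix\<close>\<close>_ \<Rightarrow>\<^sub>C\<^sub>L /_)\<close> [22, 21] 21) =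
  "{f :: 'a::complex_inner \<Rightarrow> 'b::complex_inner. bounded_clinear f}"
  morphisms cblinfun_apply CBlinfun
  by (auto simp: bounded_clinear_iff bounded_linear_zero intro!: exI[of _ "\<lambda>_. 0"])

declare [[coercion "cblinfun_apply :: ('a::complex_inner \<Rightarrow>\<^sub>C\<^sub>L 'b::complex_inner) \<Rightarrow> 'a \<Rightarrow> 'b"]]

setup_lifting type_definition_cblinfun

lemma cblinfun_bounded_linear: "bounded_linear (cblinfun_apply F)"
  using cblinfun_apply[of F] by (simp add: bounded_clinear_iff)

instantiation cblinfun :: (complex_inner, complex_inner) real_normed_vector
begin
lift_definition zero_cblinfun :: "'a \<Rightarrow>\<^sub>C\<^sub>L 'b" is "\<lambda>_. 0"
  by (simp add: bounded_clinear_iff)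
lift_definition plus_cblinfun :: "('a \<Rightarrow>\<^sub>C\<^sub>L 'b) \<Rightarrow> ('a \<Rightarrow>\<^sub>C\<^sub>L 'b) \<Rightarrow> 'a \<Rightarrow>\<^sub>C\<^sub>L 'b" is "\<lambda>f g x. f x + g x"
  by (simp add: bounded_clinear_iff bounded_linear_add complex_vector.scale_right_distrib)
lift_definition minus_cblinfun :: "('a \<Rightarrow>\<^sub>C\<^sub>L 'b) \<Rightarrow> ('a \<Rightarrow>\<^sub>C\<^sub>L 'b) \<Rightarrow> 'a \<Rightarrow>\<^sub>C\<^sub>L 'b" is "\<lambda>f g x. f x - g x"
  by (simp add: bounded_clinear_iff bounded_linear_sub complex_vector.scale_right_diff_distrib)
lift_definition uminus_cblinfun :: "('a \<Rightarrow>\<^sub>C\<^sub>L 'b) \<Rightarrow> 'a \<Rightarrow>\<^sub>C\<^sub>L 'b" is "\<lambda>f x. - f x"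
  by (simp add: bounded_clinear_iff bounded_linear_minus)
lift_definition scaleR_cblinfun :: "real \<Rightarrow> ('a \<Rightarrow>\<^sub>C\<^sub>L 'b) \<Rightarrow> 'a \<Rightarrow>\<^sub>C\<^sub>L 'b" is "\<lambda>r f x. r *\<^sub>R f x"
  unfolding bounded_clinear_iff
  by (auto simp: bounded_linear_const_scaleR) (simp add: scaleR_scaleC mult.commute)
lift_definition norm_cblinfun :: "('a \<Rightarrow>\<^sub>C\<^sub>L 'b) \<Rightarrow> real" is onorm .
definition dist_cblinfun :: "('a \<Rightarrow>\<^sub>C\<^sub>L 'b) \<Rightarrow> ('a \<Rightarrow>\<^sub>C\<^sub>L 'b) \<Rightarrow> real"
  where "dist_cblinfun F G = norm (F - G)"
definition sgn_cblinfun :: "('a \<Rightarrow>\<^sub>C\<^sub>L 'b) \<Rightarrow> 'a \<Rightarrow>\<^sub>C\<^sub>L 'b"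
  where "sgn_cblinfun F = scaleR (inverse (norm F)) F"
definition uniformity_cblinfun :: "(('a \<Rightarrow>\<^sub>C\<^sub>L 'b) \<times> ('a \<Rightarrow>\<^sub>C\<^sub>L 'b)) filter"
  where "uniformity_cblinfun = (INF e\<in>{0<..}. principal {(F, G). dist F G < e})"
definition open_cblinfun :: "('a \<Rightarrow>\<^sub>C\<^sub>L 'b) set \<Rightarrow> bool"
  where "open_cblinfun W = (\<forall>F\<in>W. \<forall>\<^sub>F (F', G) in uniformity. F' = F \<longrightarrow> G \<in> W)"
instance
proof
  fix F G :: "'a \<Rightarrow>\<^sub>C\<^sub>L 'b" and r :: real
  show "norm F = 0 \<longleftrightarrow> F = 0"
    by transfer (auto simp: bounded_clinear_iff onorm_eq_0 fun_eq_iff)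
  show "norm (F + G) \<le> norm F + norm G"
    by transfer (simp add: bounded_clinear_iff onorm_triangle)
  show "norm (r *\<^sub>R F) = \<bar>r\<bar> * norm F"
    by transfer (simp add: bounded_clinear_iff onorm_scaleR)
qed (simp_all add: dist_cblinfun_def sgn_cblinfun_def uniformity_cblinfun_def open_cblinfun_def,
    (transfer, simp add: fun_eq_iff algebra_simps)+)
end

definition cadjoint :: "('a::complex_inner \<Rightarrow> 'b::complex_inner) \<Rightarrow> 'b \<Rightarrow> 'a" where
  "cadjoint f = (THE g. \<forall>x y. cinner (f x) y = cinner x (g y))"

definition unitary_op :: "('a::complex_inner \<Rightarrow> 'a) \<Rightarrow> bool" where
  "unitary_op f \<longleftrightarrow> clinear f \<and> surj f \<and> (\<forall>x y. cinner (f x) (f y) = cinner x y)"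

definition normal_op :: "('a::complex_inner \<Rightarrow> 'a) \<Rightarrow> bool" where
  "normal_op f \<longleftrightarrow> bounded_clinear f \<and> f \<circ> cadjoint f = cadjoint f \<circ> f"

definition positive_op :: "('a::complex_inner \<Rightarrow> 'a) \<Rightarrow> bool" where
  "positive_op f \<longleftrightarrow> bounded_clinear f \<and> (\<forall>x. cinner (f x) x \<in> \<real>\<^sub>\<ge>\<^sub>0)"

text \<open>\<open>is_inverse_sqrt X R\<close> says \<open>R = X\<^sup>-\<^sup>1\<^sup>/\<^sup>2\<close>: \<open>R\<close> is the (unique) positive square root of the
  two-sided inverse of \<open>X\<close>.\<close>

definition is_inverse_sqrt :: "('a::complex_inner \<Rightarrow> 'a) \<Rightarrow> ('a \<Rightarrow> 'a) \<Rightarrow> bool" where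
  "is_inverse_sqrt X R \<longleftrightarrow> positive_op R \<and> (R \<circ> R) \<circ> X = id \<and> X \<circ> (R \<circ> R) = id"

definition hform :: "'h::complex_inner \<times> 'k::complex_inner \<Rightarrow> 'h \<times> 'k \<Rightarrow> complex" where
  "hform p q = cinner (fst p) (fst q) - cinner (snd p) (snd q)"

definition isometries :: "('h::complex_inner \<times> 'k::complex_inner \<Rightarrow> 'h \<times> 'k) set" where
  "isometries = {T. clinear T \<and> bij T \<and> (\<forall>p q. hform (T p) (T q) = hform p q)}"

definition eigenvector :: "('a::complex_inner \<Rightarrow> 'a) \<Rightarrow> 'a \<Rightarrow> bool" where
  "eigenvector T v \<longleftrightarrow> v \<noteq> 0 \<and> (\<exists>c. T v = c *\<^sub>C v)"

definition fixed_by_basis ::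
  "('h::complex_inner \<times> (complex ^ 'n) \<Rightarrow> 'h \<times> (complex ^ 'n)) \<Rightarrow> (nat \<Rightarrow> complex ^ 'n)
     \<Rightarrow> ((complex ^ 'n) \<Rightarrow>\<^sub>C\<^sub>L 'h) \<Rightarrow> bool" where
  "fixed_by_basis T z F \<longleftrightarrow> (\<forall>r\<in>{1..CARD('n)}. eigenvector T (F (z r), z r))"

definition fixed_point ::
  "('h::complex_inner \<times> (complex ^ 'n) \<Rightarrow> 'h \<times> (complex ^ 'n)) \<Rightarrow> ((complex ^ 'n) \<Rightarrow>\<^sub>C\<^sub>L 'h) \<Rightarrow> bool" where
  "fixed_point T F \<longleftrightarrow> (\<exists>z. inj_on z {1..CARD('n)}
     \<and> complex_vector.independent (z ` {1..CARD('n)})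
     \<and> complex_vector.span (z ` {1..CARD('n)}) = UNIV
     \<and> fixed_by_basis T z F)"

definition sign_tuples :: "nat \<Rightarrow> (nat \<Rightarrow> complex) set" where
  "sign_tuples q = {1..q} \<rightarrow>\<^sub>E {1, -1}"

text \<open>The set of all \<open>F\<^sub>\<theta>\<close>: a linear map is determined by its values on the basis \<open>z\<close>.\<close>

definition generic_family ::
  "(nat \<Rightarrow> complex ^ 'n) \<Rightarrow> nat \<Rightarrow> (nat \<Rightarrow> 'h::complex_inner) \<Rightarrow> ((complex ^ 'n) \<Rightarrow>\<^sub>C\<^sub>L 'h) set" where
  "generic_family z q y = {F :: (complex ^ 'n) \<Rightarrow>\<^sub>C\<^sub>L 'h. \<exists>\<theta>\<in>sign_tuples q.
     (\<forall>m\<in>{1..q}. F (z m) = \<theta> m *\<^sub>C y m) \<and> (\<forall>s\<in>{q+1..CARD('n)}. F (z s) = 0)}"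

text \<open>\<open>generic_fixed_points T G\<close>: the set \<open>G\<close> is a full system of \<open>2 ^ q\<close> fixed points of generic
  type of \<open>T\<close>. The tuples are taken to be nonempty (\<open>1 \<le> q\<close>); otherwise the zero map would be a
  generic fixed point of every unitary isometry.\<close>

definition generic_fixed_points ::
  "('h::complex_inner \<times> (complex ^ 'n) \<Rightarrow> 'h \<times> (complex ^ 'n)) \<Rightarrow> ((complex ^ 'n) \<Rightarrow>\<^sub>C\<^sub>L 'h) set \<Rightarrow> bool" where
  "generic_fixed_points T G \<longleftrightarrow> (\<exists>z q y. 1 \<le> q \<and> q \<le> CARD('n)
     \<and> inj_on z {1..CARD('n)} \<and> is_onb (z ` {1..CARD('n)})
     \<and> (\<forall>m\<in>{1..q}. y m \<noteq> 0)
     \<and> G = generic_family z q y \<and> (\<forall>F\<in>G. fixed_by_basis T z F))"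

lemma generic_fixed_points_imp_fixed_point:
  fixes T :: "'h::complex_inner \<times> (complex ^ 'n) \<Rightarrow> 'h \<times> (complex ^ 'n)"
  assumes "generic_fixed_points T G" and "F \<in> G"
  shows "fixed_point T F"
proof -
  obtain z where inj: "inj_on z {1..CARD('n)}" and onb: "is_onb (z ` {1..CARD('n)})"
    and fix_z: "fixed_by_basis T z F"
    using assms unfolding generic_fixed_points_def by blast
  let ?Z = "z ` {1..CARD('n)}"
  have "subspace (complex_vector.span ?Z)"
    unfolding subspace_def
    by (auto simp: scaleR_scaleC complex_vector.span_zero complex_vector.span_add
        complex_vector.span_scale)
  then have span: "complex_vector.span ?Z = UNIV"
    using onb closed_subspace closure_closed unfolding is_onb_def by metis
  have "complex_vector.independent ?Z"
    unfolding complex_vector.independent_explicit_finite_subsets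
  proof (intro allI impI ballI)
    fix S u v
    assume S: "S \<subseteq> ?Z" "finite S" "(\<Sum>v\<in>S. u v *\<^sub>C v) = 0" "v \<in> S"
    have sum: "cinner (\<Sum>w\<in>S. u w *\<^sub>C w) v = (\<Sum>w\<in>S. u w * cinner w v)"
      using \<open>finite S\<close>
    proof (induction S rule: finite_induct)
      case empty
      show ?case using cinner_add_left[of 0 0 v] by simp
    qed (simp add: cinner_add_left cinner_scaleC_left)
    have "(\<Sum>w\<in>S. u w * cinner w v) = (\<Sum>w\<in>S. if w = v then u v else 0)"
    proof (intro sum.cong refl)
      fix w assume "w \<in> S"
      with S(1,4) have "w \<in> ?Z" "v \<in> ?Z" by (auto simp only: subset_iff)
      with onb have "norm v = 1" "w \<noteq> v \<longrightarrow> cinner w v = 0"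
        unfolding is_onb_def by meson+
      then show "u w * cinner w v = (if w = v then u v else 0)"
        by (simp add: cinner_self)
    qed
    also have "\<dots> = u v" using S(2,4) by simp
    finally show "u v = 0"
      using sum S(3) cinner_add_left[of 0 0 v] by simp
  qed
  with inj span fix_z show ?thesis
    unfolding fixed_point_def by blast
qed

end

theory Submission
  imports Defs "HOL-Computational_Algebra.Fundamental_Theorem_Algebra"
begin

text \<open>
  Write \<open>T = S W\<close> with \<open>W = U \<oplus> V\<close> unitary and \<open>S = [[B, C], [C\<^sup>*, E]]\<close> positive. The entries of
  \<open>S\<close> satisfy \<open>B C = C E\<close>, \<open>C\<^sup>* C = E\<^sup>2 - I\<close> and \<open>C C\<^sup>* = B\<^sup>2 - I\<close>; in particular \<open>T\<close> is unitary iff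
  \<open>C = 0\<close>, and \<open>T\<close> is normal iff \<open>W\<close> commutes with \<open>S\<close>.

  If \<open>T\<close> is normal, then \<open>E V\<close> is normal on \<open>\<complex>\<^sup>n\<close>, and an orthonormal eigenbasis \<open>z\<close> of it diagonalises
  both \<open>E\<close> and \<open>V\<close>, say \<open>E z = e z\<close> and \<open>V z = v z\<close>. For \<open>C z \<noteq> 0\<close> put \<open>s\<^sup>2 = e\<^sup>2 - 1\<close> and
  \<open>y = C z / s\<close>; then \<open>(\<plusminus>y, z)\<close> are eigenvectors of \<open>T\<close> with eigenvalues \<open>v (e \<plusminus> s)\<close>. The number of
  such \<open>z\<close> is the rank \<open>k\<close> of \<open>C\<close>.

  Conversely, adding and subtracting the eigenvalue equations of \<open>(y, z)\<close> and \<open>(-y, z)\<close> shows that \<open>z\<close>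
  diagonalises \<open>E V\<close>, hence \<open>E\<close> and \<open>V\<close>, and that \<open>C z\<close> is a multiple of \<open>y\<close>, which is nonzero because
  \<open>C\<close> has rank \<open>k\<close>. This forces \<open>U y = v y\<close>, from which \<open>W\<close> commutes with \<open>S\<close>, and it makes the
  vectors \<open>y\<close> orthonormal, so that every generic fixed point has norm one.
\<close>

section \<open>Complex inner product spaces\<close>

lemma cinner_add_right: "cinner x (y + z) = cinner x y + cinner x z"
  by (metis cinner_add_left cinner_commute complex_cnj_add)

lemma cinner_scaleC_right: "cinner x (a *\<^sub>C y) = cnj a * cinner x y"
  by (metis cinner_commute cinner_scaleC_left complex_cnj_mult)

lemma cinner_zero [simp]: "cinner 0 x = 0" "cinner x 0 = 0"
  using cinner_add_left[of 0 0 x] cinner_add_right[of x 0 0] by simp_all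

lemma cinner_diff_left: "cinner (x - y) z = cinner x z - cinner y z"
  using cinner_add_left[of "x - y" y z] by simp

lemma cinner_diff_right: "cinner x (y - z) = cinner x y - cinner x z"
  using cinner_add_right[of x "y - z" z] by simp

lemma cinner_sum_left: "cinner (\<Sum>i\<in>I. f i) y = (\<Sum>i\<in>I. cinner (f i) y)"
  by (induction I rule: infinite_finite_induct) (auto simp: cinner_add_left)

lemma cinner_sum_right: "cinner y (\<Sum>i\<in>I. f i) = (\<Sum>i\<in>I. cinner y (f i))"
  by (induction I rule: infinite_finite_induct) (auto simp: cinner_add_right)

lemma cinner_self_eq_0_iff [simp]: "cinner x x = 0 \<longleftrightarrow> x = 0"
  by (simp add: cinner_self)

lemma cinner_left_extI: "(\<And>y. cinner y x = cinner y x') \<Longrightarrow> x = x'"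
  by (metis cinner_diff_right cinner_self_eq_0_iff right_minus_eq)

lemma norm_scaleC: "norm (a *\<^sub>C x) = cmod a * norm x"
proof -
  have "complex_of_real ((norm (a *\<^sub>C x))\<^sup>2) = complex_of_real ((cmod a * norm x)\<^sup>2)"
    unfolding cinner_self[symmetric] cinner_scaleC_left cinner_scaleC_right
    using complex_norm_square[of a] by (simp add: cinner_self power_mult_distrib mult_ac)
  then have "(norm (a *\<^sub>C x))\<^sup>2 = (cmod a * norm x)\<^sup>2"
    using of_real_eq_iff by blast
  then show ?thesis
    by (simp add: power2_eq_iff_nonneg)
qed

lemma clinear_add: "clinear f \<Longrightarrow> f (x + y) = f x + f y"
  and clinear_scaleC: "clinear f \<Longrightarrow> f (c *\<^sub>C x) = c *\<^sub>C f x"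
  by (simp_all add: clinear_iff)

lemma clinear_0: "clinear f \<Longrightarrow> f 0 = 0"
  using clinear_add[of f 0 0] by simp

lemma clinear_diff: "clinear f \<Longrightarrow> f (x - y) = f x - f y"
  using clinear_add[of f "x - y" y] by simp

lemma clinear_minus: "clinear f \<Longrightarrow> f (- x) = - f x"
  using clinear_diff[of f 0 x] by (simp add: clinear_0)

lemma clinear_sum: "clinear f \<Longrightarrow> f (\<Sum>i\<in>I. g i) = (\<Sum>i\<in>I. f (g i))"
  by (induction I rule: infinite_finite_induct) (auto simp: clinear_add clinear_0)

lemma bounded_clinear_imp_clinear: "bounded_clinear f \<Longrightarrow> clinear f"
  by (simp add: bounded_clinear_def)

text \<open>\<open>cadjoint\<close> is a definite description, so it has a value only once some
  \<open>g\<close> with the adjoint relation is exhibited. Uniqueness holds because inner products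
  separate vectors. Every adjoint below is obtained by naming a candidate.\<close>

lemma cadjoint_eqI:
  assumes "\<And>x y. cinner (f x) y = cinner x (g y)"
  shows "cadjoint f = g"
  unfolding cadjoint_def
proof (rule the_equality)
  fix g' assume "\<forall>x y. cinner (f x) y = cinner x (g' y)"
  then have "cinner x (g' y) = cinner x (g y)" for x y
    using assms by simp
  then show "g' = g"
    by (intro ext) (rule cinner_left_extI)
qed (use assms in blast)

section \<open>Dimension theory and adjoints on \<open>complex ^ 'n\<close>\<close>

lemma scaleC_vec_eq: "(scaleC :: complex \<Rightarrow> complex ^ 'n \<Rightarrow> complex ^ 'n) = (*s)"
  by (intro ext) (simp add: vec_eq_iff scaleC_vec_def scaleC_complex_def)

global_interpretation cvec: finite_dimensional_vector_space
  "scaleC :: complex \<Rightarrow> complex ^ 'n \<Rightarrow> complex ^ 'n" cart_basis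
  unfolding scaleC_vec_eq by unfold_locales

lemma dim_cvec: "complex_vector.dim (UNIV :: (complex ^ 'n) set) = CARD('n)"
  by (simp only: cvec.dim_UNIV cvec.dimension_def card_cart_basis)

lemma cinner_cadjoint:
  fixes f :: "complex ^ 'n \<Rightarrow> 'a::complex_inner"
  assumes "clinear f"
  shows "cinner (f x) y = cinner x (cadjoint f y)"
proof -
  \<comment> \<open>The coordinates are forced: coordinate \<open>i\<close> of \<open>g y\<close> is
    the inner product of \<open>g y\<close> with \<open>axis i 1\<close>, hence that of
    \<open>y\<close> with \<open>f (axis i 1)\<close>. Only the domain has to be
    finite-dimensional.\<close>
  define g where "g = (\<lambda>y. (\<chi> i. cinner y (f (axis i 1))) :: complex ^ 'n)"
  have g: "cinner (f x) y = cinner x (g y)" for x y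
  proof -
    have "x = (\<Sum>i\<in>UNIV. x $ i *\<^sub>C axis i 1)"
      by (simp add: scaleC_vec_eq basis_expansion)
    then have "f x = f (\<Sum>i\<in>UNIV. x $ i *\<^sub>C axis i 1)"
      by (rule arg_cong)
    also have "\<dots> = (\<Sum>i\<in>UNIV. x $ i *\<^sub>C f (axis i 1))"
      by (simp add: clinear_sum[OF assms] clinear_scaleC[OF assms])
    finally have "cinner (f x) y = (\<Sum>i\<in>UNIV. x $ i * cinner (f (axis i 1)) y)"
      by (simp add: cinner_sum_left cinner_scaleC_left)
    also have "\<dots> = cinner x (g y)"
      unfolding cinner_vec_def g_def cinner_complex_def
      by (intro sum.cong) (auto simp: cinner_commute[of "f _" y])
    finally show ?thesis .
  qed
  with cadjoint_eqI[of f g] show ?thesis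
    by simp
qed

lemma cinner_cadjoint_left:
  fixes f :: "complex ^ 'n \<Rightarrow> 'a::complex_inner"
  assumes "clinear f"
  shows "cinner (cadjoint f y) x = cinner y (f x)"
  by (metis assms cinner_cadjoint cinner_commute)

lemma clinear_cadjoint:
  fixes f :: "complex ^ 'n \<Rightarrow> 'a::complex_inner"
  assumes "clinear f"
  shows "clinear (cadjoint f)"
  unfolding clinear_iff
  by (intro conjI allI; rule cinner_left_extI)
    (simp_all add: cinner_add_right cinner_scaleC_right flip: cinner_cadjoint[OF assms])

lemma cvec_linear_dependence:
  fixes w :: "nat \<Rightarrow> complex ^ 'n"
  shows "\<exists>c. (\<exists>i\<le>CARD('n). c i \<noteq> 0) \<and> (\<Sum>i\<le>CARD('n). c i *\<^sub>C w i) = 0"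
proof (cases "inj_on w {..CARD('n)}")
  case True
  have "card (w ` {..CARD('n)}) > CARD('n)"
    using True by (simp add: card_image)
  then have "complex_vector.dependent (w ` {..CARD('n)})"
    using cvec.dim_UNIV cvec.independent_card_le_dim[of "w ` {..CARD('n)}" UNIV] dim_cvec[where 'n='n]
    by force
  then obtain u where u: "\<exists>v\<in>w ` {..CARD('n)}. u v \<noteq> 0"
      "(\<Sum>v\<in>w ` {..CARD('n)}. u v *\<^sub>C v) = 0"
    by (subst (asm) complex_vector.dependent_finite) auto
  then show ?thesis
    using True by (intro exI[of _ "u \<circ> w"]) (auto simp: sum.reindex)
next
  case False
  then obtain i j where ij: "i \<le> CARD('n)" "j \<le> CARD('n)" "i \<noteq> j" "w i = w j"
    by (auto simp: inj_on_def)
  \<comment> \<open>A repeated vector is cancelled against itself. This case matters because the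
    lemma is applied to the iterates of an operator, which may repeat.\<close>
  define c where "c l = (if l = i then 1 else if l = j then - 1 else (0::complex))" for l
  have "(\<Sum>l\<le>CARD('n). c l *\<^sub>C w l) = (\<Sum>l\<in>{i, j}. c l *\<^sub>C w l)"
    using ij by (intro sum.mono_neutral_right) (auto simp: c_def)
  also have "\<dots> = 0"
    using ij by (simp add: c_def)
  finally show ?thesis
    using ij by (intro exI[of _ c]) (auto simp: c_def)
qed

section \<open>Eigenbases of normal operators on \<open>\<complex>\<^sup>n\<close>\<close>

definition poly_op :: "complex poly \<Rightarrow> ('a::complex_inner \<Rightarrow> 'a) \<Rightarrow> 'a \<Rightarrow> 'a" where
  "poly_op p f v = (\<Sum>i\<le>degree p. coeff p i *\<^sub>C (f ^^ i) v)"

lemma poly_op_eq_sum: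
  assumes "degree p \<le> n"
  shows "poly_op p f v = (\<Sum>i\<le>n. coeff p i *\<^sub>C (f ^^ i) v)"
  unfolding poly_op_def using assms
  by (intro sum.mono_neutral_left) (auto simp: coeff_eq_0)

lemma poly_op_linear_factor:
  assumes "clinear f"
  shows "poly_op ([:- c, 1:] * q) f v = f (poly_op q f v) - c *\<^sub>C poly_op q f v"
proof -
  define n where "n = degree q"
  have deg: "degree ([:- c, 1:] * q) \<le> Suc n"
    using degree_mult_le[of "[:- c, 1:]" q] by (simp add: n_def)
  have "poly_op ([:- c, 1:] * q) f v
      = (\<Sum>i\<le>Suc n. coeff (pCons 0 q) i *\<^sub>C (f ^^ i) v) - (\<Sum>i\<le>Suc n. (c * coeff q i) *\<^sub>C (f ^^ i) v)"
    unfolding poly_op_eq_sum[OF deg]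
    by (simp add: complex_vector.scale_left_diff_distrib sum_subtractf flip: sum.distrib
        del: sum.atMost_Suc)
  also have "(\<Sum>i\<le>Suc n. coeff (pCons 0 q) i *\<^sub>C (f ^^ i) v) = (\<Sum>i\<le>n. coeff q i *\<^sub>C f ((f ^^ i) v))"
    by (subst sum.atMost_Suc_shift) simp
  also have "\<dots> = f (poly_op q f v)"
    by (simp add: poly_op_def n_def clinear_sum[OF assms] clinear_scaleC[OF assms])
  also have "(\<Sum>i\<le>Suc n. (c * coeff q i) *\<^sub>C (f ^^ i) v) = c *\<^sub>C poly_op q f v"
    by (subst poly_op_eq_sum[of q "Suc n"])
      (simp_all add: n_def complex_vector.scale_sum_right scaleC_add_right)
  finally show ?thesis .
qed

text \<open>The iterates of \<open>v\<close> are linearly dependent, so some nonzero polynomial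
  annihilates \<open>v\<close> under \<open>f\<close>. One of least degree is not constant, so it
  has a root \<open>c\<close> and a factor \<open>X - c\<close>. By minimality the cofactor
  \<open>q\<close> does not annihilate \<open>v\<close>, and \<open>poly_op q f v\<close> is the
  eigenvector; it lies in \<open>W\<close> with the iterates.\<close>

lemma eigenvector_in_invariant_subspace:
  fixes f :: "complex ^ 'n \<Rightarrow> complex ^ 'n"
  assumes f: "clinear f" and W: "complex_vector.subspace W" "\<And>x. x \<in> W \<Longrightarrow> f x \<in> W"
    and v: "v \<in> W" "v \<noteq> 0"
  obtains w c where "w \<in> W" "w \<noteq> 0" "f w = c *\<^sub>C w"
proof -
  have pow: "(f ^^ i) v \<in> W" for i
    by (induction i) (auto simp: v W)
  define P where "P p \<longleftrightarrow> p \<noteq> 0 \<and> poly_op p f v = 0" for p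
  obtain a where a: "\<exists>i\<le>CARD('n). a i \<noteq> 0" "(\<Sum>i\<le>CARD('n). a i *\<^sub>C (f ^^ i) v) = 0"
    using cvec_linear_dependence[of "\<lambda>i. (f ^^ i) v"] by blast
  define p0 where "p0 = (\<Sum>i\<le>CARD('n). monom (a i) i)"
  have coeff_p0: "coeff p0 i = (if i \<le> CARD('n) then a i else 0)" for i
    by (simp add: p0_def coeff_sum coeff_monom)
  have "degree p0 \<le> CARD('n)"
    by (intro degree_le) (simp add: coeff_p0)
  then have "P p0"
    unfolding P_def poly_op_eq_sum[OF \<open>degree p0 \<le> CARD('n)\<close>] using a
    by (auto simp: coeff_p0 poly_eq_iff)
  then obtain p where p: "P p" "\<And>q. P q \<Longrightarrow> degree p \<le> degree q"
    using ex_has_least_nat[of P p0 degree] by blast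
  have "degree p \<noteq> 0"
  proof
    assume "degree p = 0"
    with p(1) show False
      using v(2) by (auto simp: P_def poly_op_def leading_coeff_0_iff[symmetric])
  qed
  then obtain c where "poly p c = 0"
    using fundamental_theorem_of_algebra[of p] constant_degree[of p] by auto
  then obtain q where q: "p = [:- c, 1:] * q"
    by (auto simp: poly_eq_0_iff_dvd dvd_def)
  with p(1) have "q \<noteq> 0"
    by (auto simp: P_def)
  then have "degree q < degree p"
    unfolding q by (subst degree_mult_eq) auto
  show ?thesis
  proof
    show "poly_op q f v \<in> W"
      unfolding poly_op_def
      by (intro complex_vector.subspace_sum complex_vector.subspace_scale W pow)
    show "poly_op q f v \<noteq> 0"
      using p(2)[of q] \<open>degree q < degree p\<close> \<open>q \<noteq> 0\<close> by (auto simp: P_def)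
    show "f (poly_op q f v) = c *\<^sub>C poly_op q f v"
      using p(1) poly_op_linear_factor[OF f, of c q v] q by (simp add: P_def)
  qed
qed

lemma independent_orthogonal:
  assumes "0 \<notin> S" and "\<And>x y. x \<in> S \<Longrightarrow> y \<in> S \<Longrightarrow> x \<noteq> y \<Longrightarrow> cinner x y = 0"
  shows "complex_vector.independent S"
  unfolding complex_vector.independent_explicit_finite_subsets
proof (intro allI impI ballI)
  fix F u v
  assume F: "F \<subseteq> S" "finite F" "(\<Sum>v\<in>F. u v *\<^sub>C v) = 0" "v \<in> F"
  have "0 = cinner (\<Sum>w\<in>F. u w *\<^sub>C w) v"
    by (simp add: F)
  also have "\<dots> = (\<Sum>w\<in>F. if w = v then u v * cinner v v else 0)"
    unfolding cinner_sum_left cinner_scaleC_left using F assms(2)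
    by (intro sum.cong) (auto simp: subset_iff)
  also have "\<dots> = u v * cinner v v"
    using F by simp
  finally show "u v = 0"
    using F assms(1) by auto
qed

section \<open>Orthonormal bases of \<open>complex ^ 'n\<close> as sequences\<close>

definition onb_seq :: "(nat \<Rightarrow> complex ^ 'n) \<Rightarrow> bool" where
  "onb_seq z \<longleftrightarrow> inj_on z {1..CARD('n)} \<and> is_onb (z ` {1..CARD('n)})"

lemma onb_seq_cinner:
  fixes z :: "nat \<Rightarrow> complex ^ 'n"
  assumes "onb_seq z" "i \<in> {1..CARD('n)}" "j \<in> {1..CARD('n)}"
  shows "cinner (z i) (z j) = (if i = j then 1 else 0)"
proof (cases "i = j")
  case True
  have "norm (z j) = 1"
    using assms unfolding onb_seq_def is_onb_def by blast
  with True show ?thesis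
    by (simp add: cinner_self)
next
  case False
  then have "z i \<noteq> z j"
    using assms inj_on_contraD unfolding onb_seq_def by metis
  then have "cinner (z i) (z j) = 0"
    using assms unfolding onb_seq_def is_onb_def by blast
  with False show ?thesis
    by simp
qed

lemma onb_seq_norm:
  fixes z :: "nat \<Rightarrow> complex ^ 'n"
  assumes "onb_seq z" "i \<in> {1..CARD('n)}"
  shows "norm (z i) = 1"
  using assms unfolding onb_seq_def is_onb_def by blast

text \<open>\<open>is_onb\<close> asks only for a dense span, but subspaces of a finite-dimensional
  space are closed.\<close>

lemma onb_seq_span:
  fixes z :: "nat \<Rightarrow> complex ^ 'n"
  assumes "onb_seq z"
  shows "complex_vector.span (z ` {1..CARD('n)}) = UNIV"
proof -
  have "subspace (complex_vector.span (z ` {1..CARD('n)}))"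
    unfolding subspace_def
    by (auto simp: scaleR_scaleC complex_vector.span_zero complex_vector.span_add
        complex_vector.span_scale)
  then show ?thesis
    using assms closed_subspace closure_closed unfolding onb_seq_def is_onb_def by metis
qed

lemma onb_seq_expansion:
  fixes z :: "nat \<Rightarrow> complex ^ 'n"
  assumes "onb_seq z"
  shows "x = (\<Sum>i\<in>{1..CARD('n)}. cinner x (z i) *\<^sub>C z i)"
proof -
  define w where "w = x - (\<Sum>i\<in>{1..CARD('n)}. cinner x (z i) *\<^sub>C z i)"
  have orth: "cinner w (z j) = 0" if "j \<in> {1..CARD('n)}" for j
  proof -
    have "(\<Sum>i\<in>{1..CARD('n)}. cinner x (z i) * cinner (z i) (z j))
        = (\<Sum>i\<in>{1..CARD('n)}. if i = j then cinner x (z j) else 0)"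
      using onb_seq_cinner[OF assms _ that] by (intro sum.cong) simp_all
    also have "\<dots> = cinner x (z j)"
      using that by simp
    finally show ?thesis
      by (simp add: w_def cinner_diff_left cinner_sum_left cinner_scaleC_left)
  qed
  have "w \<in> complex_vector.span (z ` {1..CARD('n)})"
    by (simp only: onb_seq_span[OF assms] UNIV_I)
  then have "cinner w w = 0"
  proof (rule complex_vector.span_induct[where P = "\<lambda>y. cinner w y = 0"])
    show "complex_vector.subspace {y. cinner w y = 0}"
      by (auto simp: complex_vector.subspace_def cinner_add_right cinner_scaleC_right)
  qed (use orth in auto)
  then show ?thesis
    by (simp add: w_def)
qed

lemma onb_seq_clinear_eqI:
  fixes z :: "nat \<Rightarrow> complex ^ 'n"
  assumes "onb_seq z" "clinear f" "clinear g" "\<And>i. i \<in> {1..CARD('n)} \<Longrightarrow> f (z i) = g (z i)"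
  shows "f x = g x"
proof -
  have "f (\<Sum>i\<in>{1..CARD('n)}. cinner x (z i) *\<^sub>C z i) = g (\<Sum>i\<in>{1..CARD('n)}. cinner x (z i) *\<^sub>C z i)"
    using assms(4) by (simp add: clinear_sum clinear_scaleC assms(2,3))
  then show ?thesis
    using onb_seq_expansion[OF assms(1), of x] by simp
qed

lemma norm_sum_orthonormal:
  assumes "finite I" "\<And>i j. i \<in> I \<Longrightarrow> j \<in> I \<Longrightarrow> cinner (y i) (y j) = (if i = j then 1 else 0)"
  shows "(norm (\<Sum>i\<in>I. c i *\<^sub>C y i))\<^sup>2 = (\<Sum>i\<in>I. (cmod (c i))\<^sup>2)"
proof -
  have "complex_of_real ((norm (\<Sum>i\<in>I. c i *\<^sub>C y i))\<^sup>2)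
      = (\<Sum>i\<in>I. \<Sum>j\<in>I. c i * (cnj (c j) * cinner (y i) (y j)))"
    unfolding cinner_self[symmetric] cinner_sum_left
    by (simp add: cinner_sum_right cinner_scaleC_left cinner_scaleC_right sum_distrib_left mult_ac)
  also have "\<dots> = (\<Sum>i\<in>I. \<Sum>j\<in>I. if i = j then c i * cnj (c i) else 0)"
    by (intro sum.cong) (auto simp: assms)
  also have "\<dots> = complex_of_real (\<Sum>i\<in>I. (cmod (c i))\<^sup>2)"
    using assms(1) by (simp add: complex_norm_square flip: of_real_power)
  finally show ?thesis
    using of_real_eq_iff by blast
qed

text \<open>Expand the squared norm of \<open>g w - cnj c *\<^sub>C w\<close>: moving
  \<open>g\<close> across the inner product and commuting it with \<open>f\<close> at
  \<open>w\<close> makes all four terms cancel.\<close>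

lemma normal_eigenvector_adjoint:
  assumes adj: "\<And>x y. cinner (f x) y = cinner x (g y)"
    and comm: "f (g w) = g (f w)" and g: "clinear g" and w: "f w = c *\<^sub>C w"
  shows "g w = cnj c *\<^sub>C w"
proof -
  have 1: "cinner (g w) (g w) = c * cinner (g w) w"
    by (simp add: comm w clinear_scaleC[OF g] cinner_scaleC_left flip: adj)
  have 2: "cinner w (g w) = c * cinner w w"
    by (simp add: w cinner_scaleC_left flip: adj)
  have "cinner (g w - cnj c *\<^sub>C w) (g w - cnj c *\<^sub>C w) = 0"
    by (simp add: cinner_diff_left cinner_diff_right cinner_scaleC_left cinner_scaleC_right 1 2
        algebra_simps)
  then show ?thesis
    by simp
qed

text \<open>Take a largest orthonormal set \<open>S\<close> of eigenvectors. These are also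
  eigenvectors of the adjoint, so the orthogonal complement \<open>W\<close> of \<open>S\<close> is
  invariant under \<open>f\<close>. If \<open>W\<close> were nonzero, it would contain an
  eigenvector extending \<open>S\<close>.\<close>

lemma normal_onb_of_eigenvectors:
  fixes f :: "complex ^ 'n \<Rightarrow> complex ^ 'n"
  assumes f: "clinear f" and comm: "\<And>x. f (cadjoint f x) = cadjoint f (f x)"
  obtains z where "onb_seq z" "\<And>i. i \<in> {1..CARD('n)} \<Longrightarrow> \<exists>c. f (z i) = c *\<^sub>C z i"
proof -
  define P where "P S \<longleftrightarrow> (\<forall>x\<in>S. norm x = 1 \<and> (\<exists>c. f x = c *\<^sub>C x))
    \<and> (\<forall>x\<in>S. \<forall>y\<in>S. x \<noteq> y \<longrightarrow> cinner x y = 0)" for S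
  have indep: "complex_vector.independent S" if "P S" for S
    using that by (intro independent_orthogonal) (auto simp: P_def)
  have bound: "finite S \<and> card S \<le> CARD('n)" if "P S" for S
    using indep[OF that] cvec.independent_card_le_dim[of S UNIV] cvec.finiteI_independent
    by (simp add: dim_cvec del: cvec.dim_UNIV)
  have "P {}"
    by (simp add: P_def)
  moreover have "\<forall>S. P S \<longrightarrow> card S < Suc CARD('n)"
    using bound by (simp add: less_Suc_eq_le)
  ultimately obtain S where S: "P S" "\<And>S'. P S' \<Longrightarrow> card S' \<le> card S"
    using ex_has_greatest_nat[of P "{}" card] by blast
  define W where "W = {x. \<forall>s\<in>S. cinner x s = 0}"
  have W0: "x = 0" if "x \<in> W" for x
  proof (rule ccontr)
    assume "x \<noteq> 0"
    have "complex_vector.subspace W"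
      by (auto simp: W_def complex_vector.subspace_def cinner_add_left cinner_scaleC_left)
    moreover have "f x \<in> W" if "x \<in> W" for x
    proof -
      have "cinner (f x) s = 0" if s: "s \<in> S" for s
      proof -
        obtain c where "f s = c *\<^sub>C s"
          using S(1) s unfolding P_def by blast
        then have "cadjoint f s = cnj c *\<^sub>C s"
          by (intro normal_eigenvector_adjoint[of f])
            (simp_all add: cinner_cadjoint f comm clinear_cadjoint)
        with \<open>x \<in> W\<close> s show ?thesis
          by (simp add: cinner_cadjoint f cinner_scaleC_right W_def)
      qed
      then show ?thesis
        by (simp add: W_def)
    qed
    ultimately obtain w c where w: "w \<in> W" "w \<noteq> 0" "f w = c *\<^sub>C w"
      using eigenvector_in_invariant_subspace[OF f] \<open>x \<in> W\<close> \<open>x \<noteq> 0\<close> by metis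
    define u where "u = complex_of_real (1 / norm w) *\<^sub>C w"
    have u: "norm u = 1" "f u = c *\<^sub>C u" "\<And>s. s \<in> S \<Longrightarrow> cinner u s = 0"
      using w by (auto simp: u_def norm_scaleC norm_divide clinear_scaleC f mult_ac cinner_scaleC_left
          W_def)
    have u': "cinner s u = 0" if "s \<in> S" for s
      using u(3)[OF that] cinner_commute[of s u] by simp
    have "u \<notin> S"
      using u(1) u(3)[of u] by auto
    moreover have "P (insert u S)"
      using S(1) u u' unfolding P_def by auto
    ultimately show False
      using S(2)[of "insert u S"] bound[OF S(1)] by simp
  qed
  have "x \<in> complex_vector.span S" for x
  proof -
    define y where "y = (\<Sum>s\<in>S. cinner x s *\<^sub>C s)"
    have "cinner (x - y) s = 0" if "s \<in> S" for s
    proof -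
      have "cinner y s = (\<Sum>t\<in>S. if t = s then cinner x s else 0)"
        unfolding y_def cinner_sum_left cinner_scaleC_left using S(1) that
        by (intro sum.cong) (auto simp: P_def cinner_self)
      then show ?thesis
        using that bound[OF S(1)] by (simp add: cinner_diff_left)
    qed
    then have "x = y"
      using W0[of "x - y"] by (simp add: W_def)
    moreover have "y \<in> complex_vector.span S"
      unfolding y_def
      by (intro complex_vector.span_sum complex_vector.span_scale complex_vector.span_base)
    ultimately show ?thesis
      by simp
  qed
  then have span: "complex_vector.span S = UNIV"
    by blast
  then have "card S = CARD('n)"
    using complex_vector.dim_eq_card[of S UNIV] indep[OF S(1)] by (simp add: dim_cvec del: cvec.dim_UNIV)
  then obtain z where z: "bij_betw z {1..CARD('n)} S"
    using ex_bij_betw_nat_finite_1 bound[OF S(1)] by metis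
  show thesis
  proof
    have "z ` {1..CARD('n)} = S"
      using z by (simp add: bij_betw_def)
    then show "onb_seq z"
      unfolding onb_seq_def is_onb_def using z S(1) span by (simp add: bij_betw_def P_def)
    show "\<exists>c. f (z i) = c *\<^sub>C z i" if "i \<in> {1..CARD('n)}" for i
      using bij_betwE[OF z] S(1) that unfolding P_def by blast
  qed
qed

section \<open>Positive and unitary operators\<close>

text \<open>Complex polarisation: the sesquilinear defect \<open>b\<close> vanishes on the diagonal,
  and its values at \<open>x + y\<close> and \<open>x + \<i> *\<^sub>C y\<close> then force it to
  vanish everywhere.\<close>

lemma positive_op_selfadjoint:
  assumes "positive_op R"
  shows "cinner (R x) y = cinner x (R y)"
proof -
  have lin: "clinear R" and "\<And>x. cinner (R x) x \<in> \<real>\<^sub>\<ge>\<^sub>0"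
    using assms by (auto simp: positive_op_def bounded_clinear_imp_clinear)
  then have real: "cinner (R x) x - cinner x (R x) = 0" for x
    using cinner_commute[of x "R x"] by (metis Reals_cnj_iff eq_iff_diff_eq_0 nonneg_Reals_subset_Reals subsetD)
  define b where "b x y = cinner (R x) y - cinner x (R y)" for x y
  note simps = b_def clinear_add[OF lin] clinear_scaleC[OF lin] cinner_add_left cinner_add_right
    cinner_scaleC_left cinner_scaleC_right
  have "b (x + y) (x + y) = b x x + b y y + (b x y + b y x)"
    by (simp add: simps)
  moreover have "b (x + \<i> *\<^sub>C y) (x + \<i> *\<^sub>C y) = b x x + b y y + \<i> * (b y x - b x y)"
    by (simp add: simps algebra_simps)
  moreover have "b u u = 0" for u
    using real by (simp add: b_def)
  ultimately have "b x y + b y x = 0" "b y x - b x y = 0"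
    by simp_all
  then have "2 * b x y = 0"
    by (simp add: algebra_simps)
  then show ?thesis
    by (simp add: b_def)
qed

text \<open>Injectivity of \<open>R + r\<close>: otherwise \<open>cinner (R x) x\<close> would be
  negative. Several later equations are solved uniquely by this fact alone.\<close>

lemma positive_op_add_scaleC_eq_0:
  assumes "positive_op R" "r > 0" "R x + complex_of_real r *\<^sub>C x = 0"
  shows "x = 0"
proof -
  have "cinner (R x) x + complex_of_real (r * (norm x)\<^sup>2) = cinner (R x + complex_of_real r *\<^sub>C x) x"
    by (simp add: cinner_add_left cinner_scaleC_left cinner_self)
  then have "cinner (R x) x = complex_of_real (- (r * (norm x)\<^sup>2))"
    using assms(3) by (simp add: add_eq_0_iff)
  moreover have "cinner (R x) x \<in> \<real>\<^sub>\<ge>\<^sub>0"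
    using assms(1) by (simp add: positive_op_def)
  ultimately have "r * (norm x)\<^sup>2 \<le> 0"
    by (simp only: nonneg_Reals_of_real_iff)
  then show ?thesis
    using \<open>r > 0\<close> by (simp add: mult_le_0_iff)
qed

text \<open>Since R^2 - r^2 = (R + r)(R - r), injectivity of R + r passes from squares to square
  roots, in place of a spectral theorem on \<open>'h\<close>.\<close>

lemma positive_op_sqrt_eigenvector:
  assumes R: "positive_op R" and r: "r > 0" "R (R x) = complex_of_real (r\<^sup>2) *\<^sub>C x"
  shows "R x = complex_of_real r *\<^sub>C x"
proof -
  have lin: "clinear R"
    using R by (simp add: positive_op_def bounded_clinear_imp_clinear)
  define w where "w = R x - complex_of_real r *\<^sub>C x"
  have "R w + complex_of_real r *\<^sub>C w = 0"
    by (simp add: w_def clinear_diff[OF lin] clinear_scaleC[OF lin] r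
        complex_vector.scale_right_diff_distrib power2_eq_square)
  then show ?thesis
    using positive_op_add_scaleC_eq_0[OF R r(1), of w] by (simp add: w_def)
qed

lemma clinear_imp_bounded_linear:
  fixes f :: "complex ^ 'n \<Rightarrow> 'a::complex_inner"
  assumes "clinear f"
  shows "bounded_linear f"
proof -
  have "linear f"
    by (intro linearI) (simp_all add: clinear_add clinear_scaleC assms scaleR_scaleC)
  then show ?thesis
    by (simp add: linear_conv_bounded_linear)
qed

lemma unitary_op_imp_inj:
  assumes "unitary_op f"
  shows "inj f"
proof (rule injI)
  fix x y assume "f x = f y"
  then have "cinner (x - y) (x - y) = 0"
    using assms clinear_diff[of f x y] unfolding unitary_op_def by (metis cinner_zero(1) right_minus_eq)
  then show "x = y"
    by simp
qed

lemma unitary_op_inv: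
  assumes "unitary_op f"
  shows "f (inv f x) = x" "inv f (f x) = x" "cinner (f x) y = cinner x (inv f y)"
    "cinner x (f y) = cinner (inv f x) y"
proof -
  have surj: "surj f" and inner: "\<And>x y. cinner (f x) (f y) = cinner x y"
    using assms by (auto simp: unitary_op_def)
  show f: "f (inv f x) = x" for x
    using surj by (simp add: surj_f_inv_f)
  show "inv f (f x) = x"
    using unitary_op_imp_inj[OF assms] by simp
  show "cinner (f x) y = cinner x (inv f y)" "cinner x (f y) = cinner (inv f x) y"
    using inner f by metis+
qed

lemma unitary_op_norm: "unitary_op f \<Longrightarrow> norm (f x) = norm x"
proof -
  assume "unitary_op f"
  then have "complex_of_real ((norm (f x))\<^sup>2) = complex_of_real ((norm x)\<^sup>2)"
    by (simp only: cinner_self[symmetric] unitary_op_def)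
  then have "(norm (f x))\<^sup>2 = (norm x)\<^sup>2"
    using of_real_eq_iff by blast
  then show ?thesis
    by (simp add: power2_eq_iff_nonneg)
qed

lemma unitary_op_bounded_linear:
  assumes "unitary_op f"
  shows "bounded_linear f"
proof -
  have lin: "clinear f"
    using assms by (simp add: unitary_op_def)
  show ?thesis
    by (rule bounded_linear_intro[of _ 1])
      (simp_all add: clinear_add[OF lin] clinear_scaleC[OF lin] scaleR_scaleC unitary_op_norm[OF assms])
qed

section \<open>The block decomposition of an isometry\<close>

locale isometry_blocks =
  fixes A C :: "complex ^ 'n \<Rightarrow> 'h::complex_inner" and U B :: "'h \<Rightarrow> 'h"
    and V E :: "complex ^ 'n \<Rightarrow> complex ^ 'n"
    and T :: "'h \<times> (complex ^ 'n) \<Rightarrow> 'h \<times> (complex ^ 'n)"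
  assumes lin_A: "clinear A" and U: "unitary_op U" and V: "unitary_op V"
    and B: "is_inverse_sqrt (\<lambda>h. h - A (cadjoint A h)) B"
    and E: "is_inverse_sqrt (\<lambda>x. x - cadjoint A (A x)) E"
    and C_def: "C = B \<circ> A"
    and T: "\<And>h x. T (h, x) = (B (U h) + C (V x), cadjoint C (U h) + E (V x))"
begin

abbreviation "C' \<equiv> cadjoint C"

lemma positive: "positive_op B" "positive_op E"
  using B E by (auto simp: is_inverse_sqrt_def)

lemma lin: "clinear B" "clinear E" "clinear U" "clinear V" "clinear C" "clinear C'"
proof -
  show "clinear B" "clinear E"
    using positive by (auto simp: positive_op_def bounded_clinear_imp_clinear)
  show "clinear U" "clinear V"
    using U V by (auto simp: unitary_op_def)
  show "clinear C"
    using \<open>clinear B\<close> lin_A by (simp add: C_def clinear_iff)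
  then show "clinear C'"
    by (rule clinear_cadjoint)
qed

lemmas lin_simps = lin[THEN clinear_add] lin[THEN clinear_diff] lin[THEN clinear_scaleC]
  lin[THEN clinear_0]

lemma B_square: "B (B h) - B (B (A (cadjoint A h))) = h" "B (B h) - A (cadjoint A (B (B h))) = h"
  using B by (simp_all add: is_inverse_sqrt_def fun_eq_iff lin_simps)

lemma E_square: "E (E x) - E (E (cadjoint A (A x))) = x" "E (E x) - cadjoint A (A (E (E x))) = x"
  using E by (simp_all add: is_inverse_sqrt_def fun_eq_iff lin_simps)

lemma B_eq_0: "B h = 0 \<Longrightarrow> h = 0"
  using B_square(2)[of h] by (simp add: lin_simps clinear_0[OF lin_A] clinear_0[OF clinear_cadjoint[OF lin_A]])

lemma E_eq_0: "E x = 0 \<Longrightarrow> x = 0"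
  using E_square(2)[of x] by (simp add: lin_simps clinear_0[OF lin_A] clinear_0[OF clinear_cadjoint[OF lin_A]])

lemma B_inj: "B h = B h' \<Longrightarrow> h = h'"
  using B_eq_0[of "h - h'"] by (simp add: lin_simps)

text \<open>An eigenvector of \<open>E\<close> for \<open>e > 0\<close> is mapped by \<open>A\<close> into the eigenspace of \<open>B\<^sup>2\<close> for
  \<open>e\<^sup>2\<close>, which by positivity is the eigenspace of \<open>B\<close> for \<open>e\<close>.\<close>

lemma B_A: "B (A x) = A (E x)"
proof -
  have "cadjoint E = E"
    by (intro cadjoint_eqI positive_op_selfadjoint positive)
  then obtain z where z: "onb_seq z" "\<And>i. i \<in> {1..CARD('n)} \<Longrightarrow> \<exists>c. E (z i) = c *\<^sub>C z i"
    using normal_onb_of_eigenvectors[OF lin(2)] by metis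
  show ?thesis
  proof (rule onb_seq_clinear_eqI[OF z(1), where f = "\<lambda>x. B (A x)" and g = "\<lambda>x. A (E x)"])
    show "clinear (\<lambda>x. B (A x))" "clinear (\<lambda>x. A (E x))"
      using lin(1,2) lin_A by (simp_all add: clinear_iff)
    fix i assume i: "i \<in> {1..CARD('n)}"
    then obtain c where c: "E (z i) = c *\<^sub>C z i"
      using z(2) by blast
    have [simp]: "cinner (z i) (z i) = 1"
      using onb_seq_cinner[OF z(1) i i] by simp
    have "cinner (E (z i)) (z i) \<in> \<real>\<^sub>\<ge>\<^sub>0"
      using positive by (simp add: positive_op_def)
    then have "c \<in> \<real>\<^sub>\<ge>\<^sub>0"
      by (simp add: c cinner_scaleC_left)
    then obtain e where e: "c = complex_of_real e" "e \<ge> 0"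
      by (auto elim: nonneg_Reals_cases)
    have "z i \<noteq> 0"
      using onb_seq_norm[OF z(1) i] by auto
    then have "c \<noteq> 0"
      using E_eq_0[of "z i"] by (auto simp: c)
    with e have "e > 0"
      by auto
    have "B (B (A (z i))) = A (E (E (z i)))"
    proof -
      define u where "u = E (E (z i))"
      have "A (z i) = A u - A (cadjoint A (A u))"
        using E_square(2)[of "z i"] clinear_diff[OF lin_A] by (metis u_def)
      then show ?thesis
        using B_square(1)[of "A u"] by (simp add: lin_simps u_def)
    qed
    also have "\<dots> = complex_of_real (e\<^sup>2) *\<^sub>C A (z i)"
      by (simp add: c e lin_simps clinear_scaleC[OF lin_A] power2_eq_square)
    finally have "B (A (z i)) = c *\<^sub>C A (z i)"
      using positive_op_sqrt_eigenvector[OF positive(1) \<open>e > 0\<close>] e by simp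
    then show "B (A (z i)) = A (E (z i))"
      by (simp add: c clinear_scaleC[OF lin_A])
  qed
qed

lemma B_C: "B (C x) = C (E x)"
  by (simp add: C_def B_A)

lemma C'_eq: "C' = cadjoint A \<circ> B"
  by (intro cadjoint_eqI)
    (simp add: C_def positive_op_selfadjoint[OF positive(1)] cinner_cadjoint[OF lin_A])

lemma cinner_C: "cinner (C x) h = cinner x (C' h)" "cinner h (C x) = cinner (C' h) x"
  by (simp_all add: cinner_cadjoint cinner_cadjoint_left lin)

text \<open>C^*C = A^*B^2A = A^*A E^2 by \<open>B_A\<close>, and (I - A^*A) E^2 = I.\<close>

lemma C'_C: "C' (C x) = E (E x) - x"
  using E_square(2)[of x] by (simp add: C'_eq) (simp add: C_def B_A algebra_simps)

text \<open>C C^* = B AA^* B has its factors \<open>B\<close> on the outside. One more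
  \<open>B\<close> on the left produces B^2 AA^*, to which \<open>B_square\<close> applies, and
  \<open>B\<close> is injective.\<close>

lemma C_C': "C (C' h) = B (B h) - h"
proof (rule B_inj)
  show "B (C (C' h)) = B (B (B h) - h)"
    using B_square(1)[of "B h"] by (simp add: C'_eq) (simp add: C_def lin_simps algebra_simps)
qed

lemma B_eigenvector_of_E:
  assumes "E x = complex_of_real e *\<^sub>C x"
  shows "B (C x) = complex_of_real e *\<^sub>C C x"
  by (simp add: B_C assms lin_simps)

text \<open>By \<open>C_C'\<close> the squared norms satisfy |C^*h|^2 = |Bh|^2 - |h|^2. This makes
  C^* bounded because \<open>B\<close> is, as needed for boundedness of \<open>T\<close>.\<close>

lemma norm_C': "norm (C' h) \<le> norm (B h)"
proof -
  have "cinner (C' h) (C' h) = cinner (B h) (B h) - cinner h h"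
    by (simp add: C_C' cinner_diff_left positive_op_selfadjoint[OF positive(1)] flip: cinner_C)
  then have "complex_of_real ((norm (C' h))\<^sup>2) = complex_of_real ((norm (B h))\<^sup>2 - (norm h)\<^sup>2)"
    by (simp only: cinner_self of_real_diff)
  then have "(norm (C' h))\<^sup>2 = (norm (B h))\<^sup>2 - (norm h)\<^sup>2"
    using of_real_eq_iff by blast
  then have "(norm (C' h))\<^sup>2 \<le> (norm (B h))\<^sup>2"
    by simp
  then show ?thesis
    by (rule power2_le_imp_le) simp
qed

lemma clinear_T: "clinear T"
  unfolding clinear_iff
  by (auto simp: T lin_simps scaleC_prod_def complex_vector.scale_right_distrib algebra_simps)

lemma bounded_clinear_T: "bounded_clinear T"
proof -
  have B: "bounded_linear B"
    using positive(1) by (simp add: positive_op_def bounded_clinear_iff)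
  obtain M where M: "\<And>h. norm (B h) \<le> norm h * M"
    using bounded_linear.bounded[OF B] by blast
  have C': "bounded_linear C'"
    by (rule bounded_linear_intro[of _ M])
      (auto simp: lin_simps scaleR_scaleC intro: order_trans[OF norm_C' M])
  have T_eq: "T = (\<lambda>p. (B (U (fst p)) + C (V (snd p)), C' (U (fst p)) + E (V (snd p))))"
    by (auto simp: T)
  have "bounded_linear T"
    unfolding T_eq
    by (intro bounded_linear_Pair bounded_linear_add
        bounded_linear_compose[OF B] bounded_linear_compose[OF C']
        bounded_linear_compose[OF clinear_imp_bounded_linear[OF lin(5)]]
        bounded_linear_compose[OF clinear_imp_bounded_linear[OF lin(2)]]
        bounded_linear_compose[OF unitary_op_bounded_linear[OF U]]
        bounded_linear_compose[OF unitary_op_bounded_linear[OF V]]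
        bounded_linear_fst bounded_linear_snd)
  then show ?thesis
    using clinear_T by (simp add: bounded_clinear_iff clinear_scaleC)
qed

lemma cadjoint_T: "cadjoint T = (\<lambda>(h, x). (inv U (B h + C x), inv V (C' h + E x)))"
proof (rule cadjoint_eqI)
  fix p q :: "'h \<times> (complex ^ 'n)"
  obtain h x h' x' where pq: "p = (h, x)" "q = (h', x')"
    by (metis surj_pair)
  show "cinner (T p) q = cinner p (case q of (h, x) \<Rightarrow> (inv U (B h + C x), inv V (C' h + E x)))"
    by (simp add: pq T cinner_prod_def cinner_add_left cinner_add_right cinner_C
        positive_op_selfadjoint[OF positive(1)] positive_op_selfadjoint[OF positive(2)]
        flip: unitary_op_inv(3)[OF U] unitary_op_inv(3)[OF V])
qed

lemma T_cadjoint_T: "T (cadjoint T (h, x)) = (B (B h + C x) + C (C' h + E x), C' (B h + C x) + E (C' h + E x))"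
  by (simp add: cadjoint_T T unitary_op_inv[OF U] unitary_op_inv[OF V])

lemma normal_imp_commute:
  assumes "normal_op T"
  shows "V (E (E x)) = E (E (V x))" "U (C (E x)) = C (E (V x))"
proof -
  \<comment> \<open>Here T T^* = S^2 and T^* T = W^{-1} S^2 W. Evaluating at \<open>(0, x)\<close>
    compares second columns: that of S^2 is (2CE, 2E^2 - I), by \<open>B_C\<close> and
    \<open>C'_C\<close>.\<close>
  have "cadjoint T (T (0, x)) = T (cadjoint T (0, x))"
    using assms by (simp add: normal_op_def fun_eq_iff)
  then have "inv U (2 *\<^sub>C C (E (V x))) = 2 *\<^sub>C C (E x)"
    and "inv V (2 *\<^sub>C E (E (V x)) - V x) = 2 *\<^sub>C E (E x) - x"
    unfolding T_cadjoint_T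
    by (simp_all add: T cadjoint_T lin_simps B_C C'_C scaleC_add_left[of 1 1, simplified] algebra_simps)
  then have "2 *\<^sub>C C (E (V x)) = U (2 *\<^sub>C C (E x))" "2 *\<^sub>C E (E (V x)) - V x = V (2 *\<^sub>C E (E x) - x)"
    using unitary_op_inv[OF U] unitary_op_inv[OF V] by metis+
  then show "V (E (E x)) = E (E (V x))" "U (C (E x)) = C (E (V x))"
    by (simp_all add: lin_simps)
qed

lemma commute_imp_normal:
  assumes "\<And>h. U (B h) = B (U h)" "\<And>x. V (E x) = E (V x)" "\<And>x. U (C x) = C (V x)"
    "\<And>h. V (C' h) = C' (U h)"
  shows "normal_op T"
  unfolding normal_op_def
proof (intro conjI bounded_clinear_T ext)
  fix p :: "'h \<times> (complex ^ 'n)"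
  obtain h x where p: "p = (h, x)"
    by (metis surj_pair)
  \<comment> \<open>The commutation rules move \<open>U\<close> and \<open>V\<close> to the front,
    so T^* T becomes W^{-1} W T T^*.\<close>
  have "cadjoint T (T (h, x)) = (inv U (U (fst (T (cadjoint T (h, x))))), inv V (V (snd (T (cadjoint T (h, x))))))"
    unfolding T_cadjoint_T by (simp add: T cadjoint_T lin_simps assms)
  then show "(T \<circ> cadjoint T) p = (cadjoint T \<circ> T) p"
    by (simp add: p unitary_op_inv(2)[OF U] unitary_op_inv(2)[OF V])
qed

text \<open>If \<open>T\<close> preserves the norm of \<open>(0, inv V x)\<close>, then |Cx|^2 +
  |Ex|^2 = |x|^2, while C^*C = E^2 - I gives |Ex|^2 = |Cx|^2 + |x|^2; hence C x = 0. Conversely, C =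
  0 gives B^2 = I and E^2 = I, so by positivity both are the identity and T is the direct sum of
  \<open>U\<close> and \<open>V\<close>.\<close>

lemma unitary_iff: "unitary_op T \<longleftrightarrow> (\<forall>x. C x = 0)"
proof
  assume T_unitary: "unitary_op T"
  show "\<forall>x. C x = 0"
  proof
    fix x
    define u where "u = inv V x"
    have Vu: "V u = x"
      by (simp add: u_def unitary_op_inv[OF V])
    have 1: "cinner (E x) (E x) = cinner (C x) (C x) + cinner x x"
      unfolding cinner_C(1) C'_C cinner_diff_right by (simp add: positive_op_selfadjoint[OF positive(2)])
    have "cinner (T (0, u)) (T (0, u)) = cinner u u"
      using T_unitary by (simp add: unitary_op_def cinner_prod_def)
    also have "\<dots> = cinner x x"
      using V Vu by (metis unitary_op_def)
    finally have "cinner (C x) (C x) + cinner (E x) (E x) = cinner x x"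
      by (simp add: T lin_simps Vu cinner_prod_def)
    with 1 have "2 * cinner (C x) (C x) = 0"
      by (simp only: mult_2) (simp add: algebra_simps)
    then show "C x = 0"
      by simp
  qed
next
  assume C0: "\<forall>x. C x = 0"
  have C'0: "C' h = 0" for h
    by (rule cinner_left_extI) (simp add: C0 flip: cinner_C)
  have B1: "B h = h" for h
    using positive_op_sqrt_eigenvector[OF positive(1), of 1 h] C_C'[of h] C0 by simp
  have E1: "E x = x" for x
    using positive_op_sqrt_eigenvector[OF positive(2), of 1 x] C'_C[of x] C'0 by simp
  have T_eq: "T (h, x) = (U h, V x)" for h x
    by (simp add: T C0 C'0 B1 E1)
  show "unitary_op T"
    unfolding unitary_op_def
  proof (intro conjI clinear_T allI)
    show "surj T"
    proof (rule surjI)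
      show "T (inv U (fst p), inv V (snd p)) = p" for p
        by (simp add: T_eq unitary_op_inv[OF U] unitary_op_inv[OF V])
    qed
    show "cinner (T p) (T q) = cinner p q" for p q
      using U V by (cases p; cases q) (simp add: T_eq cinner_prod_def unitary_op_def)
  qed
qed

end

section \<open>Generic families\<close>

lemma onb_seq_cinner_eqI:
  fixes z :: "nat \<Rightarrow> complex ^ 'n"
  assumes "onb_seq z" "\<And>i. i \<in> {1..CARD('n)} \<Longrightarrow> cinner (z i) x = cinner (z i) y"
  shows "x = y"
proof (rule cinner_left_extI)
  show "cinner u x = cinner u y" for u
    by (rule onb_seq_clinear_eqI[OF assms(1), where f = "\<lambda>u. cinner u x" and g = "\<lambda>u. cinner u y"])
      (use assms(2) in \<open>simp_all add: clinear_iff cinner_add_left cinner_scaleC_left scaleC_complex_def\<close>)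
qed

text \<open>An operator that is diagonal in an orthonormal basis has the conjugate diagonal as its
  adjoint; normality is a consequence here, not an assumption.\<close>

lemma cadjoint_onb_eigenvector:
  fixes z :: "nat \<Rightarrow> complex ^ 'n"
  assumes z: "onb_seq z" and f: "clinear f"
    and eig: "\<And>i. i \<in> {1..CARD('n)} \<Longrightarrow> f (z i) = c i *\<^sub>C z i" and i: "i \<in> {1..CARD('n)}"
  shows "cadjoint f (z i) = cnj (c i) *\<^sub>C z i"
proof (rule onb_seq_cinner_eqI[OF z])
  fix j assume j: "j \<in> {1..CARD('n)}"
  show "cinner (z j) (cadjoint f (z i)) = cinner (z j) (cnj (c i) *\<^sub>C z i)"
    unfolding cinner_cadjoint[OF f, symmetric] eig[OF j] cinner_scaleC_left cinner_scaleC_right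
      onb_seq_cinner[OF z j i] by simp
qed

lemma cblinfun_clinear: "clinear (cblinfun_apply F)"
  using cblinfun_apply[of F] by (simp add: bounded_clinear_imp_clinear)

lemma cblinfun_eqI_onb:
  fixes F F' :: "(complex ^ 'n) \<Rightarrow>\<^sub>C\<^sub>L 'h::complex_inner"
  assumes "onb_seq z" "\<And>i. i \<in> {1..CARD('n)} \<Longrightarrow> F (z i) = F' (z i)"
  shows "F = F'"
proof -
  have "F x = F' x" for x
    using onb_seq_clinear_eqI[OF assms(1) cblinfun_clinear cblinfun_clinear assms(2)] by blast
  then show ?thesis
    by (simp add: cblinfun_apply_inject[symmetric] fun_eq_iff)
qed

lemma cblinfun_with_values_on_onb:
  fixes z :: "nat \<Rightarrow> complex ^ 'n" and w :: "nat \<Rightarrow> 'h::complex_inner"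
  assumes z: "onb_seq z"
  obtains F :: "(complex ^ 'n) \<Rightarrow>\<^sub>C\<^sub>L 'h" where "\<And>i. i \<in> {1..CARD('n)} \<Longrightarrow> F (z i) = w i"
proof -
  define f where "f x = (\<Sum>i\<in>{1..CARD('n)}. cinner x (z i) *\<^sub>C w i)" for x
  have lin: "clinear f"
    by (auto simp: clinear_iff f_def cinner_add_left cinner_scaleC_left scaleC_add_left sum.distrib
        complex_vector.scale_sum_right)
  then have "bounded_clinear f"
    using clinear_imp_bounded_linear[OF lin] by (simp add: bounded_clinear_iff clinear_scaleC)
  moreover have "f (z i) = w i" if i: "i \<in> {1..CARD('n)}" for i
  proof -
    have "f (z i) = (\<Sum>j\<in>{1..CARD('n)}. if i = j then w j else 0)"
      unfolding f_def using onb_seq_cinner[OF z i] by (intro sum.cong) simp_all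
    then show ?thesis
      using i by simp
  qed
  ultimately show thesis
    using that[of "CBlinfun f"] by (simp add: CBlinfun_inverse)
qed

lemma generic_family_member:
  fixes z :: "nat \<Rightarrow> complex ^ 'n" and y :: "nat \<Rightarrow> 'h::complex_inner"
  assumes z: "onb_seq z" and q: "q \<le> CARD('n)" and \<theta>: "\<theta> \<in> sign_tuples q"
  obtains F where "F \<in> generic_family z q y" "\<And>m. m \<in> {1..q} \<Longrightarrow> F (z m) = \<theta> m *\<^sub>C y m"
    "\<And>s. s \<in> {q+1..CARD('n)} \<Longrightarrow> F (z s) = 0"
proof -
  obtain F :: "(complex ^ 'n) \<Rightarrow>\<^sub>C\<^sub>L 'h"
    where F: "\<And>i. i \<in> {1..CARD('n)} \<Longrightarrow> F (z i) = (if i \<le> q then \<theta> i *\<^sub>C y i else 0)"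
    using cblinfun_with_values_on_onb[OF z, of "\<lambda>i. if i \<le> q then \<theta> i *\<^sub>C y i else 0"] by blast
  have "F (z m) = \<theta> m *\<^sub>C y m" if "m \<in> {1..q}" for m
    using F[of m] that q by simp
  moreover have "F (z s) = 0" if "s \<in> {q+1..CARD('n)}" for s
    using F[of s] that by simp
  moreover from calculation have "F \<in> generic_family z q y"
    using \<theta> by (auto simp: generic_family_def)
  ultimately show thesis
    using that by blast
qed

text \<open>Different sign tuples give different maps because no \<open>y m\<close> vanishes. The
  count later turns a cardinality of 2^k into q = k.\<close>

lemma card_generic_family:
  fixes z :: "nat \<Rightarrow> complex ^ 'n" and y :: "nat \<Rightarrow> 'h::complex_inner"
  assumes z: "onb_seq z" and q: "q \<le> CARD('n)" and y: "\<And>m. m \<in> {1..q} \<Longrightarrow> y m \<noteq> 0"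
  shows "card (generic_family z q y) = 2 ^ q"
proof -
  have "\<exists>F\<in>generic_family z q y. (\<forall>m\<in>{1..q}. F (z m) = \<theta> m *\<^sub>C y m)
      \<and> (\<forall>s\<in>{q+1..CARD('n)}. F (z s) = 0)" if "\<theta> \<in> sign_tuples q" for \<theta>
    by (rule generic_family_member[OF z q that, of y]) blast
  then have "\<exists>F. \<forall>\<theta>\<in>sign_tuples q. F \<theta> \<in> generic_family z q y \<and> (\<forall>m\<in>{1..q}. F \<theta> (z m) = \<theta> m *\<^sub>C y m)
      \<and> (\<forall>s\<in>{q+1..CARD('n)}. F \<theta> (z s) = 0)"
    by (intro bchoice) blast
  then obtain F where F: "\<And>\<theta>. \<theta> \<in> sign_tuples q \<Longrightarrow> F \<theta> \<in> generic_family z q y"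
      "\<And>\<theta> m. \<theta> \<in> sign_tuples q \<Longrightarrow> m \<in> {1..q} \<Longrightarrow> F \<theta> (z m) = \<theta> m *\<^sub>C y m"
      "\<And>\<theta> s. \<theta> \<in> sign_tuples q \<Longrightarrow> s \<in> {q+1..CARD('n)} \<Longrightarrow> F \<theta> (z s) = 0"
    by metis
  have "inj_on F (sign_tuples q)"
  proof (rule inj_onI)
    fix \<theta> \<theta>' assume \<theta>: "\<theta> \<in> sign_tuples q" "\<theta>' \<in> sign_tuples q" "F \<theta> = F \<theta>'"
    have "\<theta> m = \<theta>' m" if "m \<in> {1..q}" for m
      using F(2)[OF \<theta>(1) that] F(2)[OF \<theta>(2) that] \<theta>(3) y[OF that] by simp
    \<comment> \<open>Sign tuples are extensional functions, equal to \<open>undefined\<close>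
      outside \<open>{1..q}\<close>, so agreement on \<open>{1..q}\<close> is enough.\<close>
    then show "\<theta> = \<theta>'"
      using \<theta>(1,2) unfolding sign_tuples_def by (rule PiE_ext[rotated 2])
  qed
  moreover have "F ` sign_tuples q = generic_family z q y"
  proof (intro equalityI subsetI)
    fix G assume "G \<in> generic_family z q y"
    then obtain \<theta> where \<theta>: "\<theta> \<in> sign_tuples q" "\<And>m. m \<in> {1..q} \<Longrightarrow> G (z m) = \<theta> m *\<^sub>C y m"
        "\<And>s. s \<in> {q+1..CARD('n)} \<Longrightarrow> G (z s) = 0"
      unfolding generic_family_def by blast
    have "G = F \<theta>"
    proof (rule cblinfun_eqI_onb[OF z])
      fix i assume "i \<in> {1..CARD('n)}"
      then have "i \<in> {1..q} \<or> i \<in> {q+1..CARD('n)}"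
        by auto
      then show "G (z i) = F \<theta> (z i)"
        using \<theta> F by metis
    qed
    with \<theta> show "G \<in> F ` sign_tuples q"
      by blast
  qed (use F(1) in blast)
  ultimately have "card (generic_family z q y) = card (sign_tuples q)"
    using card_image by metis
  also have "\<dots> = 2 ^ q"
    by (simp add: sign_tuples_def card_PiE numeral_2_eq_2)
  finally show ?thesis .
qed

text \<open>\<open>F\<close> carries orthonormal vectors to orthonormal vectors up to sign, or to
  zero, so Parseval bounds its norm by one. The bound is attained at \<open>z 1\<close>, which is
  among the first \<open>q\<close> vectors because q is at least 1.\<close>

lemma generic_family_norm:
  fixes z :: "nat \<Rightarrow> complex ^ 'n" and y :: "nat \<Rightarrow> 'h::complex_inner"
  assumes z: "onb_seq z" and q: "1 \<le> q" "q \<le> CARD('n)"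
    and y: "\<And>i j. i \<in> {1..q} \<Longrightarrow> j \<in> {1..q} \<Longrightarrow> cinner (y i) (y j) = (if i = j then 1 else 0)"
    and F: "F \<in> generic_family z q y"
  shows "norm F = 1"
proof (rule antisym)
  obtain \<theta> where \<theta>: "\<theta> \<in> sign_tuples q" "\<And>m. m \<in> {1..q} \<Longrightarrow> F (z m) = \<theta> m *\<^sub>C y m"
      "\<And>s. s \<in> {q+1..CARD('n)} \<Longrightarrow> F (z s) = 0"
    using F unfolding generic_family_def by blast
  have norm_\<theta>: "cmod (\<theta> m) = 1" if "m \<in> {1..q}" for m
    using \<theta>(1) PiE_mem[of \<theta> "{1..q}" "\<lambda>_. {1, -1}" m] that by (auto simp: sign_tuples_def)
  have "norm (F x) \<le> 1 * norm x" for x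
  proof -
    have "F x = F (\<Sum>i\<in>{1..CARD('n)}. cinner x (z i) *\<^sub>C z i)"
      by (rule arg_cong[OF onb_seq_expansion[OF z]])
    also have "\<dots> = (\<Sum>i\<in>{1..CARD('n)}. cinner x (z i) *\<^sub>C F (z i))"
      by (simp add: clinear_sum[OF cblinfun_clinear] clinear_scaleC[OF cblinfun_clinear])
    also have "\<dots> = (\<Sum>i\<in>{1..q}. cinner x (z i) *\<^sub>C F (z i))"
      using q \<theta>(3) by (intro sum.mono_neutral_right) auto
    also have "\<dots> = (\<Sum>i\<in>{1..q}. (cinner x (z i) * \<theta> i) *\<^sub>C y i)"
      using \<theta>(2) by (intro sum.cong) simp_all
    finally have "(norm (F x))\<^sup>2 = (\<Sum>i\<in>{1..q}. (cmod (cinner x (z i) * \<theta> i))\<^sup>2)"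
      using norm_sum_orthonormal[of "{1..q}" y] y by simp
    also have "\<dots> = (\<Sum>i\<in>{1..q}. (cmod (cinner x (z i)))\<^sup>2)"
      using norm_\<theta> by (intro sum.cong) (simp_all add: norm_mult)
    also have "\<dots> \<le> (\<Sum>i\<in>{1..CARD('n)}. (cmod (cinner x (z i)))\<^sup>2)"
      using q by (intro sum_mono2) auto
    also have "\<dots> = (norm (\<Sum>i\<in>{1..CARD('n)}. cinner x (z i) *\<^sub>C z i))\<^sup>2"
      using norm_sum_orthonormal[of "{1..CARD('n)}" z] onb_seq_cinner[OF z] by simp
    also have "\<dots> = (norm x)\<^sup>2"
      by (simp only: onb_seq_expansion[OF z, of x, symmetric])
    finally show ?thesis
      using power2_le_imp_le[of "norm (F x)" "norm x"] by simp
  qed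
  then show "norm F \<le> 1"
    unfolding norm_cblinfun.rep_eq by (intro onorm_bound) auto
  have 1: "(1::nat) \<in> {1..q}" "(1::nat) \<in> {1..CARD('n)}"
    using q by auto
  have "(1::complex) = complex_of_real ((norm (y 1))\<^sup>2)"
    using y[OF 1(1) 1(1)] by (simp add: cinner_self)
  then have "norm (y 1) = 1"
    by (metis norm_ge_zero of_real_eq_1_iff power2_eq_1_iff power2_eq_iff_nonneg one_power2 zero_le_one)
  then have "norm (F (z 1)) = 1"
    using \<theta>(2)[OF 1(1)] norm_\<theta>[OF 1(1)] by (simp add: norm_scaleC)
  then show "1 \<le> norm F"
    using onorm[OF cblinfun_bounded_linear, of F "z 1"] onb_seq_norm[OF z 1(2)]
    by (simp add: norm_cblinfun.rep_eq)
qed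

section \<open>Normal isometries and their generic fixed points\<close>

context isometry_blocks
begin

text \<open>Separates the polar factors of EV. Its adjoint V^{-1}E has the conjugate eigenvalue, so
  E z = cnj c V z and E^2 z = |c|^2 z. Positivity gives e = |c|, and v = c / |c| follows by
  injectivity of \<open>E\<close>.\<close>

lemma EV_eigenbasis:
  assumes z: "onb_seq z" and eig: "\<And>i. i \<in> {1..CARD('n)} \<Longrightarrow> \<exists>c. E (V (z i)) = c *\<^sub>C z i"
    and i: "i \<in> {1..CARD('n)}"
  obtains e v where "e > 0" "v \<noteq> 0" "E (z i) = complex_of_real e *\<^sub>C z i" "V (z i) = v *\<^sub>C z i"
proof -
  obtain c where c: "\<And>i. i \<in> {1..CARD('n)} \<Longrightarrow> E (V (z i)) = c i *\<^sub>C z i"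
    using eig by metis
  define M where "M x = E (V x)" for x
  have "clinear M"
    by (simp add: M_def clinear_iff lin_simps)
  have adj: "cadjoint M = (\<lambda>x. inv V (E x))"
    by (intro cadjoint_eqI)
      (simp add: M_def positive_op_selfadjoint[OF positive(2)] unitary_op_inv(3)[OF V])
  have "inv V (E (z i)) = cnj (c i) *\<^sub>C z i"
    using cadjoint_onb_eigenvector[OF z \<open>clinear M\<close> _ i, of c] c by (simp add: adj M_def)
  then have "E (z i) = cnj (c i) *\<^sub>C V (z i)"
    using unitary_op_inv(1)[OF V, of "E (z i)"] by (simp add: lin_simps)
  then have EE: "E (E (z i)) = (cnj (c i) * c i) *\<^sub>C z i"
    by (simp add: lin_simps c[OF i])
  have "z i \<noteq> 0"
    using onb_seq_norm[OF z i] by auto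
  have "c i \<noteq> 0"
  proof
    assume "c i = 0"
    then have "E (E (z i)) = 0"
      by (simp add: EE)
    then show False
      using E_eq_0 \<open>z i \<noteq> 0\<close> by blast
  qed
  have "cnj (c i) * c i = complex_of_real ((cmod (c i))\<^sup>2)"
    using complex_norm_square[of "c i"] by (simp add: mult_ac)
  with EE have E: "E (z i) = complex_of_real (cmod (c i)) *\<^sub>C z i"
    using \<open>c i \<noteq> 0\<close> by (intro positive_op_sqrt_eigenvector[OF positive(2)]) simp_all
  have "E (V (z i) - (c i / cmod (c i)) *\<^sub>C z i) = 0"
    using \<open>c i \<noteq> 0\<close> by (simp add: lin_simps c[OF i] E)
  then have "V (z i) = (c i / cmod (c i)) *\<^sub>C z i"
    using E_eq_0 right_minus_eq by blast
  with E show thesis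
    using that[of "cmod (c i)" "c i / cmod (c i)"] \<open>c i \<noteq> 0\<close> by simp
qed

lemma C_eq_0_iff: "C' (C x) = 0 \<longleftrightarrow> C x = 0"
proof
  assume "C' (C x) = 0"
  then have "cinner (C x) (C x) = 0"
    by (simp add: cinner_C)
  then show "C x = 0"
    by simp
qed (simp add: lin_simps)

lemma range_C_subset_span:
  assumes z: "onb_seq z" and J: "\<And>i. i \<in> {1..CARD('n)} \<Longrightarrow> i \<notin> J \<Longrightarrow> C (z i) = 0"
  shows "range C \<subseteq> complex_vector.span ((\<lambda>i. C (z i)) ` J)"
proof
  fix h assume "h \<in> range C"
  then obtain x where "h = C x"
    by blast
  also have "\<dots> = C (\<Sum>i\<in>{1..CARD('n)}. cinner x (z i) *\<^sub>C z i)"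
    by (rule arg_cong[OF onb_seq_expansion[OF z]])
  also have "\<dots> = (\<Sum>i\<in>{1..CARD('n)}. cinner x (z i) *\<^sub>C C (z i))"
    by (simp add: clinear_sum[OF lin(5)] lin_simps)
  also have "\<dots> \<in> complex_vector.span ((\<lambda>i. C (z i)) ` J)"
  proof (intro complex_vector.span_sum complex_vector.span_scale)
    fix i assume "i \<in> {1..CARD('n)}"
    then show "C (z i) \<in> complex_vector.span ((\<lambda>i. C (z i)) ` J)"
      using J complex_vector.span_zero by (cases "i \<in> J") (auto intro: complex_vector.span_base)
  qed
  finally show "h \<in> complex_vector.span ((\<lambda>i. C (z i)) ` J)" .
qed

text \<open>C^*C = E^2 - I sends \<open>z j\<close> to a multiple of itself, which is orthogonal to
  \<open>z i\<close>.\<close>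

lemma C_eigenvectors_orthogonal:
  assumes z: "onb_seq z" and ij: "i \<in> {1..CARD('n)}" "j \<in> {1..CARD('n)}" "i \<noteq> j"
    and E: "E (z j) = e *\<^sub>C z j"
  shows "cinner (C (z i)) (C (z j)) = 0"
  using onb_seq_cinner[OF z ij(1,2)] ij(3)
  by (simp add: cinner_C(1) C'_C E lin_simps cinner_diff_right cinner_scaleC_right)

lemma dim_range_C:
  assumes z: "onb_seq z" and E: "\<And>i. i \<in> {1..CARD('n)} \<Longrightarrow> \<exists>e. E (z i) = e *\<^sub>C z i"
  shows "complex_vector.dim (range C) = card {i \<in> {1..CARD('n)}. C (z i) \<noteq> 0}"
proof -
  define J where "J = {i \<in> {1..CARD('n)}. C (z i) \<noteq> 0}"
  have orth: "cinner (C (z i)) (C (z j)) = 0" if "i \<in> J" "j \<in> J" "i \<noteq> j" for i j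
    using C_eigenvectors_orthogonal[OF z] E that unfolding J_def by blast
  have inj: "inj_on (\<lambda>i. C (z i)) J"
  proof (rule inj_onI, rule ccontr)
    fix i j assume "i \<in> J" "j \<in> J" "C (z i) = C (z j)" "i \<noteq> j"
    then have "cinner (C (z i)) (C (z i)) = 0"
      using orth by metis
    with \<open>i \<in> J\<close> show False
      by (simp add: J_def)
  qed
  have "complex_vector.dim (range C) = card ((\<lambda>i. C (z i)) ` J)"
  proof (rule complex_vector.dim_unique[OF _ _ _ refl])
    show "(\<lambda>i. C (z i)) ` J \<subseteq> range C"
      by blast
    show "range C \<subseteq> complex_vector.span ((\<lambda>i. C (z i)) ` J)"
      by (intro range_C_subset_span[OF z]) (auto simp: J_def)
    show "complex_vector.independent ((\<lambda>i. C (z i)) ` J)"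
    proof (rule independent_orthogonal)
      show "0 \<notin> (\<lambda>i. C (z i)) ` J"
        by (auto simp: J_def)
      show "cinner x y = 0" if "x \<in> (\<lambda>i. C (z i)) ` J" "y \<in> (\<lambda>i. C (z i)) ` J" "x \<noteq> y" for x y
        using that orth by blast
    qed
  qed
  with inj show ?thesis
    by (simp add: card_image J_def)
qed

lemma normal_nonunitary_imp_generic:
  assumes normal: "normal_op T" and nonunitary: "\<not> unitary_op T"
    and k: "complex_vector.dim (range C) = k"
  shows "\<exists>G. generic_fixed_points T G \<and> card G = 2 ^ k"
proof -
  define M where "M x = E (V x)" for x
  have adj: "cadjoint M = (\<lambda>x. inv V (E x))"
    by (intro cadjoint_eqI)
      (simp add: M_def positive_op_selfadjoint[OF positive(2)] unitary_op_inv(3)[OF V])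
  have "clinear M"
    by (simp add: M_def clinear_iff lin_simps)
  \<comment> \<open>The two products are E^2 and V^{-1} E^2 V, which agree since normality of
    \<open>T\<close> makes \<open>V\<close> commute with E^2.\<close>
  moreover have "M (cadjoint M x) = cadjoint M (M x)" for x
    by (simp add: adj M_def unitary_op_inv[OF V] flip: normal_imp_commute(1)[OF normal])
  ultimately obtain z0 where z0: "onb_seq z0" "\<And>i. i \<in> {1..CARD('n)} \<Longrightarrow> \<exists>c. M (z0 i) = c *\<^sub>C z0 i"
    using normal_onb_of_eigenvectors by metis
  define J where "J = {i \<in> {1..CARD('n)}. C (z0 i) \<noteq> 0}"
  have EV0: "\<exists>e v. e > 0 \<and> E (z0 i) = complex_of_real e *\<^sub>C z0 i \<and> V (z0 i) = v *\<^sub>C z0 i"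
    if "i \<in> {1..CARD('n)}" for i
    using EV_eigenbasis[OF z0(1) _ that] z0(2) unfolding M_def by metis
  then have card_J: "card J = k"
    using dim_range_C[OF z0(1)] k unfolding J_def by metis
  have "J \<subseteq> {1..CARD('n)}"
    by (auto simp: J_def)
  then have k_le: "k \<le> CARD('n)"
    using card_mono[of "{1..CARD('n)}" J] card_J by simp
  have "finite J"
    using \<open>J \<subseteq> {1..CARD('n)}\<close> finite_subset by blast
  obtain \<sigma>1 where \<sigma>1: "bij_betw \<sigma>1 {1..k} J"
    using finite_same_card_bij[of "{1..k}" J] \<open>finite J\<close> card_J by auto
  have "card ({1..CARD('n)} - J) = CARD('n) - k"
    using card_Diff_subset[OF \<open>finite J\<close> \<open>J \<subseteq> _\<close>] card_J by simp
  then obtain \<sigma>2 where \<sigma>2: "bij_betw \<sigma>2 {k+1..CARD('n)} ({1..CARD('n)} - J)"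
    using finite_same_card_bij[of "{k+1..CARD('n)}" "{1..CARD('n)} - J"] by auto
  \<comment> \<open>A generic family puts its nonzero vectors first, so the eigenbasis is permuted
    to have the indices in \<open>J\<close> at positions \<open>1..k\<close>.\<close>
  define \<sigma> where "\<sigma> i = (if i \<in> {1..k} then \<sigma>1 i else \<sigma>2 i)" for i
  have "bij_betw \<sigma> {1..k} J"
    using \<sigma>1 by (rule bij_betw_cong[THEN iffD1, rotated]) (simp add: \<sigma>_def)
  moreover have "bij_betw \<sigma> {k+1..CARD('n)} ({1..CARD('n)} - J)"
    using \<sigma>2 by (rule bij_betw_cong[THEN iffD1, rotated]) (simp add: \<sigma>_def)
  ultimately have \<sigma>: "bij_betw \<sigma> {1..k} J" "bij_betw \<sigma> {k+1..CARD('n)} ({1..CARD('n)} - J)"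
    "bij_betw \<sigma> ({1..k} \<union> {k+1..CARD('n)}) (J \<union> ({1..CARD('n)} - J))"
    using bij_betw_combine[of \<sigma> "{1..k}" J "{k+1..CARD('n)}" "{1..CARD('n)} - J"] by auto
  have "{1..k} \<union> {k+1..CARD('n)} = {1..CARD('n)}" "J \<union> ({1..CARD('n)} - J) = {1..CARD('n)}"
    using k_le \<open>J \<subseteq> _\<close> by auto
  with \<sigma>(3) have \<sigma>_bij: "bij_betw \<sigma> {1..CARD('n)} {1..CARD('n)}"
    by simp
  define z where "z = z0 \<circ> \<sigma>"
  have onb: "onb_seq z"
  proof -
    have "inj_on z {1..CARD('n)}"
      unfolding z_def using \<sigma>_bij z0(1) by (intro comp_inj_on) (auto simp: bij_betw_def onb_seq_def)
    moreover have "z ` {1..CARD('n)} = z0 ` {1..CARD('n)}"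
      unfolding z_def image_comp[symmetric] using \<sigma>_bij by (simp add: bij_betw_def)
    ultimately show ?thesis
      using z0(1) by (simp add: onb_seq_def)
  qed
  have "\<exists>e v. e > 0 \<and> E (z i) = complex_of_real e *\<^sub>C z i \<and> V (z i) = v *\<^sub>C z i"
    if "i \<in> {1..CARD('n)}" for i
    using EV0[OF bij_betwE[OF \<sigma>_bij, rule_format, OF that]] by (simp add: z_def)
  then obtain e v where ev: "\<And>i. i \<in> {1..CARD('n)} \<Longrightarrow> e i > 0"
      "\<And>i. i \<in> {1..CARD('n)} \<Longrightarrow> E (z i) = complex_of_real (e i) *\<^sub>C z i"
      "\<And>i. i \<in> {1..CARD('n)} \<Longrightarrow> V (z i) = v i *\<^sub>C z i"
    by metis
  have Cz: "C (z i) \<noteq> 0" if "i \<in> {1..k}" for i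
    using bij_betwE[OF \<sigma>(1)] that by (auto simp: J_def z_def)
  have Cz0: "C (z i) = 0" if "i \<in> {k+1..CARD('n)}" for i
    using bij_betwE[OF \<sigma>(2), rule_format, OF that] by (auto simp: J_def z_def)
  have UC: "U (C (z i)) = v i *\<^sub>C C (z i)" if i: "i \<in> {1..CARD('n)}" for i
    using normal_imp_commute(2)[OF normal, of "z i"] ev(1)[OF i]
    by (simp add: ev(2,3)[OF i] lin_simps complex_vector.scale_left_commute[of "v i"] del: complex_vector.scale_scale)
  \<comment> \<open>The complex root needs no prior proof that \<open>e i\<close> is at least 1;
    only its square enters.\<close>
  define s where "s i = csqrt ((complex_of_real (e i))\<^sup>2 - 1)" for i
  have s2: "s i * s i = (complex_of_real (e i))\<^sup>2 - 1" for i
    by (simp add: s_def flip: power2_eq_square)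
  have C'C: "C' (C (z i)) = (s i * s i) *\<^sub>C z i" if i: "i \<in> {1..CARD('n)}" for i
    by (simp add: C'_C ev(2)[OF i] lin_simps s2 complex_vector.scale_left_diff_distrib power2_eq_square)
  have s_nz: "s i \<noteq> 0" if i: "i \<in> {1..k}" for i
  proof
    assume "s i = 0"
    then have "C' (C (z i)) = 0"
      using C'C[of i] i k_le by simp
    with Cz[OF i] show False
      by (simp add: C_eq_0_iff)
  qed
  \<comment> \<open>This scaling gives C z = s y and C^* y = s z. On the span of (y, 0) and (0, z),
    \<open>T\<close> is then v times the symmetric matrix with diagonal e and off-diagonal s, whose
    eigenvectors are (y, z) and (-y, z).\<close>
  define y where "y i = (1 / s i) *\<^sub>C C (z i)" for i
  have y_nz: "y m \<noteq> 0" if "m \<in> {1..k}" for m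
    using Cz[OF that] s_nz[OF that] by (simp add: y_def)
  have z_nz: "z i \<noteq> 0" if "i \<in> {1..CARD('n)}" for i
    using onb_seq_norm[OF onb that] by auto
  have eig: "eigenvector T (\<epsilon> *\<^sub>C y m, z m)" if m: "m \<in> {1..k}" and \<epsilon>: "\<epsilon> \<in> {1, -1}" for m \<epsilon>
  proof -
    have m': "m \<in> {1..CARD('n)}"
      using m k_le by simp
    have \<epsilon>2: "\<epsilon> * \<epsilon> = 1"
      using \<epsilon> by auto
    have "fst (T (\<epsilon> *\<^sub>C y m, z m)) = (\<epsilon> / s m * v m * e m + v m) *\<^sub>C C (z m)"
      by (simp add: T y_def lin_simps ev(2,3)[OF m'] UC[OF m'] B_C scaleC_add_left mult_ac)
    also have "\<epsilon> / s m * v m * e m + v m = (v m * (e m + \<epsilon> * s m)) * (\<epsilon> / s m)"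
      using s_nz[OF m] \<epsilon>2 by (simp add: field_simps)
    finally have 1: "fst (T (\<epsilon> *\<^sub>C y m, z m)) = (v m * (e m + \<epsilon> * s m)) *\<^sub>C \<epsilon> *\<^sub>C y m"
      by (simp add: y_def)
    have "snd (T (\<epsilon> *\<^sub>C y m, z m)) = (\<epsilon> / s m * v m * (s m * s m) + v m * e m) *\<^sub>C z m"
      by (simp add: T y_def lin_simps ev(2,3)[OF m'] UC[OF m'] C'C[OF m'] scaleC_add_left mult_ac)
    also have "\<epsilon> / s m * v m * (s m * s m) + v m * e m = v m * (e m + \<epsilon> * s m)"
      using s_nz[OF m] by (simp add: field_simps)
    finally have "T (\<epsilon> *\<^sub>C y m, z m) = (v m * (e m + \<epsilon> * s m)) *\<^sub>C (\<epsilon> *\<^sub>C y m, z m)"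
      using 1 by (simp add: prod_eq_iff scaleC_prod_def)
    then show ?thesis
      using z_nz[OF m'] unfolding eigenvector_def by (metis prod.inject zero_prod_def)
  qed
  have eig0: "eigenvector T (0, z i)" if i: "i \<in> {k+1..CARD('n)}" for i
  proof -
    have i': "i \<in> {1..CARD('n)}"
      using i by simp
    have "T (0, z i) = (v i * e i) *\<^sub>C (0, z i)"
      by (simp add: T lin_simps ev(2,3)[OF i'] Cz0[OF i] scaleC_prod_def)
    then show ?thesis
      using z_nz[OF i'] unfolding eigenvector_def by (metis prod.inject zero_prod_def)
  qed
  have "fixed_by_basis T z F" if "F \<in> generic_family z k y" for F
    unfolding fixed_by_basis_def
  proof
    fix i assume "i \<in> {1..CARD('n)}"
    then consider "i \<in> {1..k}" | "i \<in> {k+1..CARD('n)}"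
      by fastforce
    then show "eigenvector T (F (z i), z i)"
    proof cases
      case 1
      then obtain \<epsilon> where "\<epsilon> \<in> {1, -1}" "F (z i) = \<epsilon> *\<^sub>C y i"
        using \<open>F \<in> _\<close> unfolding generic_family_def sign_tuples_def by blast
      with eig[OF 1] show ?thesis
        by simp
    next
      case 2
      then have "F (z i) = 0"
        using \<open>F \<in> _\<close> unfolding generic_family_def by blast
      with eig0[OF 2] show ?thesis
        by simp
    qed
  qed
  moreover have "1 \<le> k"
  proof (rule ccontr)
    assume "\<not> 1 \<le> k"
    then have "C (z i) = 0" if "i \<in> {1..CARD('n)}" for i
      using Cz0[of i] that by simp
    then have "range C \<subseteq> complex_vector.span ((\<lambda>i. C (z i)) ` {})"
      by (intro range_C_subset_span[OF onb]) simp
    then have "\<forall>x. C x = 0"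
      by auto
    with nonunitary show False
      by (simp add: unitary_iff)
  qed
  ultimately have "generic_fixed_points T (generic_family z k y)"
    using onb y_nz k_le unfolding generic_fixed_points_def onb_seq_def by blast
  moreover have "card (generic_family z k y) = 2 ^ k"
    using onb k_le y_nz by (rule card_generic_family)
  ultimately show ?thesis
    by blast
qed

end

section \<open>From generic fixed points back to normality\<close>

lemma generic_fixed_points_eigenvectors:
  fixes T :: "'h::complex_inner \<times> (complex ^ 'n) \<Rightarrow> 'h \<times> (complex ^ 'n)"
  assumes G: "generic_fixed_points T G"
  obtains z q y where "onb_seq z" "1 \<le> q" "q \<le> CARD('n)" "\<And>m. m \<in> {1..q} \<Longrightarrow> y m \<noteq> 0"
    "G = generic_family z q y"
    "\<And>m. m \<in> {1..q} \<Longrightarrow> eigenvector T (y m, z m) \<and> eigenvector T (- y m, z m)"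
    "\<And>s. s \<in> {q+1..CARD('n)} \<Longrightarrow> eigenvector T (0, z s)"
proof -
  obtain z q y where z: "onb_seq z" and q: "1 \<le> q" "q \<le> CARD('n)"
    and y: "\<And>m. m \<in> {1..q} \<Longrightarrow> y m \<noteq> 0" and G_eq: "G = generic_family z q y"
    and fixd: "\<And>F. F \<in> G \<Longrightarrow> fixed_by_basis T z F"
    using G unfolding generic_fixed_points_def onb_seq_def by blast
  have eig: "eigenvector T (\<epsilon> *\<^sub>C y m, z m)" if m: "m \<in> {1..q}" and \<epsilon>: "\<epsilon> \<in> {1, -1}" for m \<epsilon>
  proof -
    \<comment> \<open>The two constant sign tuples suffice to obtain both eigenvectors for every
      \<open>m\<close>.\<close>
    have \<theta>: "(\<lambda>i\<in>{1..q}. \<epsilon>) \<in> sign_tuples q"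
      using \<epsilon> by (auto simp: sign_tuples_def)
    obtain F where F: "F \<in> generic_family z q y"
        "\<And>m. m \<in> {1..q} \<Longrightarrow> F (z m) = (\<lambda>i\<in>{1..q}. \<epsilon>) m *\<^sub>C y m"
        "\<And>s. s \<in> {q+1..CARD('n)} \<Longrightarrow> F (z s) = 0"
      by (rule generic_family_member[OF z q(2) \<theta>, of y]) (rule that; blast)
    have "m \<in> {1..CARD('n)}"
      using m q by simp
    then have "eigenvector T (F (z m), z m)"
      using fixd[of F] F(1) unfolding fixed_by_basis_def G_eq by blast
    then show ?thesis
      using F(2)[OF m] m by simp
  qed
  have eig0: "eigenvector T (0, z s)" if s: "s \<in> {q+1..CARD('n)}" for s
  proof -
    have \<theta>: "(\<lambda>i\<in>{1..q}. 1) \<in> sign_tuples q"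
      by (auto simp: sign_tuples_def)
    obtain F where F: "F \<in> generic_family z q y"
        "\<And>m. m \<in> {1..q} \<Longrightarrow> F (z m) = (\<lambda>i\<in>{1..q}. 1) m *\<^sub>C y m"
        "\<And>s. s \<in> {q+1..CARD('n)} \<Longrightarrow> F (z s) = 0"
      by (rule generic_family_member[OF z q(2) \<theta>, of y]) (rule that; blast)
    have "s \<in> {1..CARD('n)}"
      using s by simp
    then have "eigenvector T (F (z s), z s)"
      using fixd[of F] F(1) unfolding fixed_by_basis_def G_eq by blast
    then show ?thesis
      using F(3)[OF s] by simp
  qed
  have "eigenvector T (y m, z m) \<and> eigenvector T (- y m, z m)" if "m \<in> {1..q}" for m
    using eig[OF that, of 1] eig[OF that, of "-1"] by simp
  with z q y G_eq eig0 show thesis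
    using that by blast
qed

context isometry_blocks
begin

lemma generic_eigenvector_blocks:
  assumes "eigenvector T (y, z)" "eigenvector T (- y, z)"
  obtains c d where "E (V z) = c *\<^sub>C z" "C (V z) = d *\<^sub>C y" "B (U y) = c *\<^sub>C y" "C' (U y) = d *\<^sub>C z"
proof -
  obtain a b where "T (y, z) = a *\<^sub>C (y, z)" "T (- y, z) = b *\<^sub>C (- y, z)"
    using assms unfolding eigenvector_def by blast
  then have *: "B (U y) + C (V z) = a *\<^sub>C y" "C' (U y) + E (V z) = a *\<^sub>C z"
    "- B (U y) + C (V z) = - (b *\<^sub>C y)" "- C' (U y) + E (V z) = b *\<^sub>C z"
    by (simp_all add: T scaleC_prod_def lin[THEN clinear_minus])
  have half: "u = ((1 / 2) * c) *\<^sub>C w" if "u + u = c *\<^sub>C w" for u w :: "'x::complex_inner" and c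
  proof -
    have "((1 / 2) * c) *\<^sub>C w = (1 / 2) *\<^sub>C (u + u)"
      by (simp add: that)
    also have "\<dots> = (1 / 2 + 1 / 2) *\<^sub>C u"
      by (simp only: scaleC_add_right scaleC_add_left)
    finally show ?thesis
      by simp
  qed
  \<comment> \<open>The witnesses are half the sum and half the difference of the two
    eigenvalues.\<close>
  have "E (V z) + E (V z) = (a + b) *\<^sub>C z" "B (U y) + B (U y) = (a + b) *\<^sub>C y"
    "C (V z) + C (V z) = (a - b) *\<^sub>C y" "C' (U y) + C' (U y) = (a - b) *\<^sub>C z"
    unfolding scaleC_add_left complex_vector.scale_left_diff_distrib
    using * by (simp_all add: algebra_simps flip: *(1,2,4))
  then show thesis
    using that half by metis
qed

lemma generic_fixed_points_structure:
  assumes z: "onb_seq z" and q: "q \<le> CARD('n)" "complex_vector.dim (range C) = q"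
    and y: "\<And>m. m \<in> {1..q} \<Longrightarrow> y m \<noteq> 0"
    and eig: "\<And>m. m \<in> {1..q} \<Longrightarrow> eigenvector T (y m, z m) \<and> eigenvector T (- y m, z m)"
    and eig0: "\<And>s. s \<in> {q+1..CARD('n)} \<Longrightarrow> eigenvector T (0, z s)"
  obtains e v t where
    "\<And>i. i \<in> {1..CARD('n)} \<Longrightarrow> E (z i) = complex_of_real (e i) *\<^sub>C z i"
    "\<And>i. i \<in> {1..CARD('n)} \<Longrightarrow> V (z i) = v i *\<^sub>C z i"
    "\<And>m. m \<in> {1..q} \<Longrightarrow> t m \<noteq> 0 \<and> C (z m) = t m *\<^sub>C y m \<and> U (y m) = v m *\<^sub>C y m
        \<and> C' (y m) = t m *\<^sub>C z m"
    "\<And>s. s \<in> {q+1..CARD('n)} \<Longrightarrow> C (z s) = 0"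
proof -
  have blocks: "\<exists>c d. E (V (z m)) = c *\<^sub>C z m \<and> C (V (z m)) = d *\<^sub>C y m \<and> B (U (y m)) = c *\<^sub>C y m
      \<and> C' (U (y m)) = d *\<^sub>C z m" if "m \<in> {1..q}" for m
    using generic_eigenvector_blocks[of "y m" "z m"] eig[OF that] by metis
  then obtain c d where cd: "\<And>m. m \<in> {1..q} \<Longrightarrow> E (V (z m)) = c m *\<^sub>C z m"
      "\<And>m. m \<in> {1..q} \<Longrightarrow> C (V (z m)) = d m *\<^sub>C y m"
      "\<And>m. m \<in> {1..q} \<Longrightarrow> B (U (y m)) = c m *\<^sub>C y m"
      "\<And>m. m \<in> {1..q} \<Longrightarrow> C' (U (y m)) = d m *\<^sub>C z m"
    by metis
  have blocks0: "\<exists>a. E (V (z s)) = a *\<^sub>C z s \<and> C (V (z s)) = 0" if s: "s \<in> {q+1..CARD('n)}" for s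
    using eig0[OF s] unfolding eigenvector_def by (auto simp: T lin_simps scaleC_prod_def)
  have split: "i \<in> {1..q} \<or> i \<in> {q+1..CARD('n)}" if "i \<in> {1..CARD('n)}" for i
    using that by auto
  have EV: "\<exists>c. E (V (z i)) = c *\<^sub>C z i" if "i \<in> {1..CARD('n)}" for i
    using split[OF that] blocks blocks0 by blast
  have "\<exists>e v. v \<noteq> 0 \<and> E (z i) = complex_of_real e *\<^sub>C z i \<and> V (z i) = v *\<^sub>C z i"
    if "i \<in> {1..CARD('n)}" for i
    using EV_eigenbasis[OF z EV that] by metis
  then obtain e v where ev: "\<And>i. i \<in> {1..CARD('n)} \<Longrightarrow> v i \<noteq> 0"
      "\<And>i. i \<in> {1..CARD('n)} \<Longrightarrow> E (z i) = complex_of_real (e i) *\<^sub>C z i"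
      "\<And>i. i \<in> {1..CARD('n)} \<Longrightarrow> V (z i) = v i *\<^sub>C z i"
    by metis
  have C0: "C (z s) = 0" if "s \<in> {q+1..CARD('n)}" for s
    using blocks0[OF that] ev(1,3)[of s] that by (auto simp: lin_simps)
  \<comment> \<open>Rank count: if one of the q images vanished, the remaining q - 1 would span a
    range of dimension q.\<close>
  have C_nz: "C (z m) \<noteq> 0" if m: "m \<in> {1..q}" for m
  proof
    assume "C (z m) = 0"
    then have "range C \<subseteq> complex_vector.span ((\<lambda>i. C (z i)) ` ({1..q} - {m}))"
      using C0 split by (intro range_C_subset_span[OF z]) blast
    then have "q \<le> card ((\<lambda>i. C (z i)) ` ({1..q} - {m}))"
      using complex_vector.dim_le_card q(2) by blast
    also have "\<dots> \<le> card ({1..q} - {m})"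
      by (intro card_image_le) simp
    also have "\<dots> < q"
      using m by simp
    finally show False
      by simp
  qed
  have main: "d m / v m \<noteq> 0 \<and> C (z m) = (d m / v m) *\<^sub>C y m \<and> U (y m) = v m *\<^sub>C y m
        \<and> C' (y m) = (d m / v m) *\<^sub>C z m" if m: "m \<in> {1..q}" for m
  proof -
    have m': "m \<in> {1..CARD('n)}"
      using m q(1) by simp
    have "v m *\<^sub>C C (z m) = d m *\<^sub>C y m"
      using cd(2)[OF m] by (simp add: ev(3)[OF m'] lin_simps)
    then have "(1 / v m) *\<^sub>C v m *\<^sub>C C (z m) = (1 / v m) *\<^sub>C d m *\<^sub>C y m"
      by (rule arg_cong)
    then have Cz: "C (z m) = (d m / v m) *\<^sub>C y m"
      using ev(1)[OF m'] by simp
    with C_nz[OF m] have t: "d m / v m \<noteq> 0"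
      by auto
    have "z m \<noteq> 0"
      using onb_seq_norm[OF z m'] by auto
    then have c: "c m = v m * e m"
      using cd(1)[OF m] by (simp add: ev(2,3)[OF m'] lin_simps)
    \<comment> \<open>B C = C E shows that \<open>C (z m)\<close>, hence \<open>y m\<close>, is an
      eigenvector of \<open>B\<close> for \<open>e m\<close>. Then B (U y) = v e y = B (v y), and
      injectivity of \<open>B\<close> identifies U y.\<close>
    have "(d m / v m) *\<^sub>C B (y m) = (d m / v m) *\<^sub>C complex_of_real (e m) *\<^sub>C y m"
      using B_eigenvector_of_E[OF ev(2)[OF m']] by (simp add: Cz lin_simps mult_ac)
    then have "B (y m) = complex_of_real (e m) *\<^sub>C y m"
      using t complex_vector.scale_cancel_left by blast
    then have "B (U (y m)) = B (v m *\<^sub>C y m)"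
      by (simp add: cd(3)[OF m] c lin_simps)
    then have Uy: "U (y m) = v m *\<^sub>C y m"
      by (rule B_inj)
    have "v m *\<^sub>C C' (y m) = d m *\<^sub>C z m"
      using cd(4)[OF m] by (simp add: Uy lin_simps)
    then have "(1 / v m) *\<^sub>C v m *\<^sub>C C' (y m) = (1 / v m) *\<^sub>C d m *\<^sub>C z m"
      by (rule arg_cong)
    then have "C' (y m) = (d m / v m) *\<^sub>C z m"
      using ev(1)[OF m'] by simp
    with t Cz Uy show ?thesis
      by blast
  qed
  show thesis
    using that[of e v "\<lambda>m. d m / v m"] ev main C0 by blast
qed

text \<open>That is, \<open>B = I + C (E + I)\<^sup>-\<^sup>1 C\<^sup>*\<close>; it reduces commutation of \<open>U\<close> with the square root \<open>B\<close> to
  commutation with \<open>C\<close>, \<open>C\<^sup>*\<close> and \<open>E\<close>, without a functional calculus on the space of \<open>B\<close>.\<close>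

lemma B_decomposition:
  obtains w where "E w + w = C' h" "B h = h + C w"
proof -
  have clin: "clinear (\<lambda>x. E x + x)"
    by (simp add: clinear_iff lin_simps scaleC_add_right)
  moreover have "inj (\<lambda>x. E x + x)"
  proof (rule injI)
    fix x y assume eq: "E x + x = E y + y"
    have "E (x - y) + complex_of_real 1 *\<^sub>C (x - y) = (E x + x) - (E y + y)"
      by (simp add: lin_simps)
    with eq have "E (x - y) + complex_of_real 1 *\<^sub>C (x - y) = 0"
      by simp
    then show "x = y"
      using positive_op_add_scaleC_eq_0[OF positive(2), of 1 "x - y"] by simp
  qed
  ultimately have "surj (\<lambda>x. E x + x)"
    by (rule cvec.linear_inj_imp_surj)
  from surjD[OF this, of "C' h"] obtain w where w: "E w + w = C' h"
    by auto
  define u where "u = B h - h - C w"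
  have "B u + complex_of_real 1 *\<^sub>C u = (B (B h) - h) - C (E w + w)"
    by (simp add: u_def lin_simps B_C algebra_simps)
  also have "\<dots> = 0"
    by (simp add: w C_C')
  finally have "u = 0"
    using positive_op_add_scaleC_eq_0[OF positive(1), of 1 u] by simp
  with w show thesis
    by (intro that[of w]) (simp_all add: u_def algebra_simps)
qed

text \<open>\<open>W\<close> is shown to commute with \<open>S\<close> entry by entry: with
  \<open>E\<close> and \<open>C\<close> on the basis, with C^* by taking adjoints, and with
  \<open>B\<close> through \<open>B_decomposition\<close>.\<close>

lemma generic_structure_imp_normal:
  assumes z: "onb_seq z"
    and E: "\<And>i. i \<in> {1..CARD('n)} \<Longrightarrow> E (z i) = e i *\<^sub>C z i"
    and V: "\<And>i. i \<in> {1..CARD('n)} \<Longrightarrow> V (z i) = v i *\<^sub>C z i"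
    and C: "\<And>m. m \<in> {1..q} \<Longrightarrow> C (z m) = t m *\<^sub>C y m \<and> U (y m) = v m *\<^sub>C y m"
    and C0: "\<And>s. s \<in> {q+1..CARD('n)} \<Longrightarrow> C (z s) = 0"
  shows "normal_op T"
proof -
  have VE: "V (E x) = E (V x)" for x
    by (rule onb_seq_clinear_eqI[OF z, where f = "\<lambda>x. V (E x)" and g = "\<lambda>x. E (V x)"])
      (simp_all add: clinear_iff lin_simps E V mult_ac)
  have UC: "U (C x) = C (V x)" for x
  proof (rule onb_seq_clinear_eqI[OF z, where f = "\<lambda>x. U (C x)" and g = "\<lambda>x. C (V x)"])
    fix i assume i: "i \<in> {1..CARD('n)}"
    then consider "i \<in> {1..q}" | "i \<in> {q+1..CARD('n)}"
      by fastforce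
    then show "U (C (z i)) = C (V (z i))"
      by cases (simp_all add: C C0 V[OF i] lin_simps mult_ac)
  qed (simp_all add: clinear_iff lin_simps)
  have VC': "V (C' h) = C' (U h)" for h
  proof (rule cinner_left_extI)
    fix x
    have "U (C (inv V x)) = C x"
      by (simp add: UC unitary_op_inv[OF isometry_blocks.V[OF isometry_blocks_axioms]])
    then have "C (inv V x) = inv U (C x)"
      using unitary_op_inv(2)[OF U] by metis
    then show "cinner x (V (C' h)) = cinner x (C' (U h))"
      by (simp add: unitary_op_inv(4)[OF U] unitary_op_inv(4)[OF isometry_blocks.V[OF isometry_blocks_axioms]]
          flip: cinner_C)
  qed
  have "U (B h) = B (U h)" for h
  proof -
    obtain w where w: "E w + w = C' h" "B h = h + C w"
      using B_decomposition .
    obtain w' where w': "E w' + w' = C' (U h)" "B (U h) = U h + C w'"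
      using B_decomposition .
    \<comment> \<open>\<open>V w\<close> and \<open>w'\<close> both solve (E + I) x = C^* U h, whose
      solution is unique.\<close>
    have "E (V w - w') + complex_of_real 1 *\<^sub>C (V w - w') = V (E w + w) - (E w' + w')"
      by (simp add: lin_simps VE algebra_simps)
    also have "\<dots> = 0"
      by (simp add: w w' VC')
    finally have "V w = w'"
      using positive_op_add_scaleC_eq_0[OF positive(2), of 1 "V w - w'"] by simp
    then show ?thesis
      by (simp add: w(2) w'(2) lin_simps UC)
  qed
  with VE UC VC' show ?thesis
    by (intro commute_imp_normal)
qed

lemma generic_fixed_points_imp:
  assumes G: "generic_fixed_points T G" "card G = 2 ^ k" and k: "complex_vector.dim (range C) = k"
  shows "normal_op T" "\<not> unitary_op T" "\<And>F. F \<in> G \<Longrightarrow> norm F = 1"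
proof -
  obtain z q y where z: "onb_seq z" and q: "1 \<le> q" "q \<le> CARD('n)"
    and y: "\<And>m. m \<in> {1..q} \<Longrightarrow> y m \<noteq> 0" and G_eq: "G = generic_family z q y"
    and eig: "\<And>m. m \<in> {1..q} \<Longrightarrow> eigenvector T (y m, z m) \<and> eigenvector T (- y m, z m)"
    and eig0: "\<And>s. s \<in> {q+1..CARD('n)} \<Longrightarrow> eigenvector T (0, z s)"
    by (rule generic_fixed_points_eigenvectors[OF G(1)]) (rule that; blast)
  have "card G = 2 ^ q"
    unfolding G_eq using z q(2) y by (rule card_generic_family)
  with G(2) k have dim: "complex_vector.dim (range C) = q"
    by simp
  obtain e v t where E: "\<And>i. i \<in> {1..CARD('n)} \<Longrightarrow> E (z i) = complex_of_real (e i) *\<^sub>C z i"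
    and V: "\<And>i. i \<in> {1..CARD('n)} \<Longrightarrow> V (z i) = v i *\<^sub>C z i"
    and C: "\<And>m. m \<in> {1..q} \<Longrightarrow> t m \<noteq> 0 \<and> C (z m) = t m *\<^sub>C y m \<and> U (y m) = v m *\<^sub>C y m
        \<and> C' (y m) = t m *\<^sub>C z m"
    and C0: "\<And>s. s \<in> {q+1..CARD('n)} \<Longrightarrow> C (z s) = 0"
    by (rule generic_fixed_points_structure[OF z q(2) dim y eig eig0]) (assumption | rule that; blast)+
  show "normal_op T"
    using z E V C C0 by (intro generic_structure_imp_normal[of z _ v q t y]) blast+
  show "\<not> unitary_op T"
  proof
    assume "unitary_op T"
    then have "C (z 1) = 0"
      by (simp add: unitary_iff)
    with C[of 1] y[of 1] q show False
      by simp
  qed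
  \<comment> \<open>Evaluate \<open>cinner (C (z i)) (y j)\<close> through C z = t y and through C^*
    y = t z. On the diagonal only moduli are compared, since \<open>t i\<close> is not known to be
    real.\<close>
  have orthonormal: "cinner (y i) (y j) = (if i = j then 1 else 0)" if ij: "i \<in> {1..q}" "j \<in> {1..q}" for i j
  proof -
    have i: "i \<in> {1..CARD('n)}" and j: "j \<in> {1..CARD('n)}"
      using ij q(2) by auto
    have "t i * cinner (y i) (y j) = cinner (C (z i)) (y j)"
      using C[OF ij(1)] by (simp add: cinner_scaleC_left)
    also have "\<dots> = cnj (t j) * cinner (z i) (z j)"
      using C[OF ij(2)] by (simp add: cinner_C(1) cinner_scaleC_right)
    finally have *: "t i * cinner (y i) (y j) = (if i = j then cnj (t j) else 0)"
      by (simp add: onb_seq_cinner[OF z i j])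
    show ?thesis
    proof (cases "i = j")
      case True
      then have "cmod (t i) * cmod (cinner (y i) (y i)) = cmod (t i)"
        using arg_cong[OF *, of cmod] by (simp add: norm_mult)
      then have "cmod (cinner (y i) (y i)) = 1"
        using C[OF ij(1)] by simp
      then have "(norm (y i))\<^sup>2 = 1"
        by (simp add: cinner_self norm_power)
      with True show ?thesis
        by (simp add: cinner_self)
    next
      case False
      with * C[OF ij(1)] show ?thesis
        by simp
    qed
  qed
  show "norm F = 1" if "F \<in> G" for F
    using generic_family_norm[OF z q orthonormal] that unfolding G_eq by blast
qed

end

theorem theorem1p4:
  fixes T :: "'h::chilbert_space \<times> (complex ^ 'n) \<Rightarrow> 'h \<times> (complex ^ 'n)"
    and A :: "(complex ^ 'n) \<Rightarrow>\<^sub>C\<^sub>L 'h"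
    and U B :: "'h \<Rightarrow> 'h"
    and V E :: "complex ^ 'n \<Rightarrow> complex ^ 'n"
    and C :: "complex ^ 'n \<Rightarrow> 'h"
    and k :: nat
  assumes "\<not> same_hilbert_dim TYPE('h) TYPE(complex ^ 'n)"
    and "T \<in> isometries"
    and "A \<in> ball 0 1" and "unitary_op U" and "unitary_op V"
    and "is_inverse_sqrt (\<lambda>h. h - A (cadjoint A h)) B"
    and "C = B \<circ> A"
    and "is_inverse_sqrt (\<lambda>x. x - cadjoint A (A x)) E"
    and "\<And>h x. T (h, x) = (B (U h) + C (V x), cadjoint C (U h) + E (V x))"
    and "complex_vector.dim (range C) = k"
  shows "(normal_op T \<and> \<not> unitary_op T \<longleftrightarrow> (\<exists>G. generic_fixed_points T G \<and> card G = 2 ^ k))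
    \<and> (\<forall>G. generic_fixed_points T G \<and> card G = 2 ^ k \<longrightarrow> G \<subseteq> frontier (ball 0 1))"
proof -
  interpret isometry_blocks A C U B V E T
    using cblinfun_clinear assms(4-6,8,7,9) by (rule isometry_blocks.intro)
  show ?thesis
    using normal_nonunitary_imp_generic[OF _ _ assms(10)] generic_fixed_points_imp[OF _ _ assms(10)]
    \<comment> \<open>The frontier of the open unit ball is the unit sphere, so norm one is what
      remains for the boundary claim.\<close>
    by (auto simp: subset_iff)
qed

end
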